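(* Let $K\ge2$ be a fixed integer, let $\sigma_1=1$ and $\sigma_k>1$ for $k=2,\dots,K$. Let $(n_1,\dots,n_K)$ be a sequence of $K$-tuples of positive integers (indexed by $n$) such that $n_k\to\infty$ as $n\to\infty$ for every $k\in\{1,\dots,K\}$. For each $k$ let $X^{(k)}_1,\dots,X^{(k)}_{n_k}$ be i.i.d. $N(0,\sigma_k^2)$ random variables, with the collections for different $k$ mutually independent, and put $M^{(k)}_{n_k}:=\max_{1\le i\le n_k}X^{(k)}_i$. Define $\boldsymbol p_n=(p_{n,1},\dots,p_{n,K})$ by $$p_{n,k}:=\mathbb P\bigl(M^{(k)}_{n_k}>M^{(j)}_{n_j}\ \text{for all } j\neq k\bigr),\qquad k=1,\dots,K,$$ and $\boldsymbol\beta_n=(\beta_{n,1},\dots,\beta_{n,K})$ by $$\beta_{n,1}:=1,\qquad \beta_{n,k}:=\frac{n_1}{n_k^{\sigma_k^2}(\log n_k)^{-(\sigma_k^2-1)/2}},\quad k=2,\dots,K.$$ Then $\boldsymbol p_n$ converges to a limit $\boldsymbol p=(p_1,\dots,p_K)\in(0,1)^K$ if and only if $\boldsymbol\beta_n$ converges to some $\boldsymbol C=(C_1,\dots,C_K)\in(0,\infty)^K$. Under this condition, for each $k=1,\dots,K$, $$p_k=\mathbb P\Bigl(\sigma_k^2(\Lambda_k-\kappa(C_k,\sigma_k))>\sigma_j^2(\Lambda_j-\kappa(C_j,\sigma_j))\ \text{for all } j\neq k\Bigr),$$ where $\Lambda_1,\dots,\Lambda_K$ are independent Gumbel random variables, $C_1=1$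 and $\kappa(C_1,\sigma_1)=0$. Equivalently, for each $k=1,\dots,K$, $$p_k=\int_0^\infty \frac{e^{-\kappa(C_k,\sigma_k)}}{\sigma_k^2}\,x^{1/\sigma_k^2-1}\exp\Bigl(-\sum_{j=1}^K e^{-\kappa(C_j,\sigma_j)}\,x^{1/\sigma_j^2}\Bigr)\,\mathrm dx .$$
   Context: For $C>0$ and $\sigma>0$, $$\kappa(C,\sigma)=\frac{1}{\sigma^2}\log\frac{C}{\sigma}+\frac12\Bigl(1-\frac1{\sigma^2}\Bigr)\log(4\pi),$$ so that $\kappa(1,1)=0$. A Gumbel random variable is one with distribution function $F_\Lambda(x)=\exp(-e^{-x})$, $x\in\mathbb R$. $N(0,s^2)$ denotes the centered Gaussian distribution with variance $s^2$. The quantities $\beta_{n,k}$ with $k\ge2$ are considered for $n$ large enough that $n_k\ge2$. *)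

theory Defs
  imports "HOL-Probability.Probability"
begin

definition kappa :: "real \<Rightarrow> real \<Rightarrow> real" where
  "kappa C \<sigma> = 1 / \<sigma>\<^sup>2 * ln (C / \<sigma>) + 1 / 2 * (1 - 1 / \<sigma>\<^sup>2) * ln (4 * pi)"

definition gumbel_rv :: "'b measure \<Rightarrow> ('b \<Rightarrow> real) \<Rightarrow> bool" where
  "gumbel_rv P L \<longleftrightarrow>
     L \<in> borel_measurable P \<and> (\<forall>x. cdf (distr P borel L) x = exp (- exp (- x)))"

definition sample_max :: "(nat \<Rightarrow> 'a \<Rightarrow> real) \<Rightarrow> nat \<Rightarrow> 'a \<Rightarrow> real" where
  "sample_max X m \<omega> = Max ((\<lambda>i. X i \<omega>) ` {1..m})"

definition win_prob :: "'a measure \<Rightarrow> nat \<Rightarrow> (nat \<Rightarrow> 'a \<Rightarrow> real) \<Rightarrow> nat \<Rightarrow> real" where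
  "win_prob P K Y k =
     measure P {\<omega> \<in> space P. \<forall>j \<in> {1..K} - {k}. Y k \<omega> > Y j \<omega>}"

text \<open>
  The arguments of \<open>beta_ratio\<close> are the tuples \<open>(\<sigma>_1,...,\<sigma>_K)\<close> and \<open>(n_1,...,n_K)\<close> and the
  index \<open>k\<close>. For \<open>k \<noteq> 1\<close> the value is only meaningful when \<open>n_k \<ge> 2\<close>; it is used only in
  limits along which every \<open>n_k\<close> tends to infinity.
\<close>

definition beta_ratio :: "(nat \<Rightarrow> real) \<Rightarrow> (nat \<Rightarrow> nat) \<Rightarrow> nat \<Rightarrow> real" where
  "beta_ratio \<sigma> m k =
     (if k = 1 then 1
      else real (m 1) /
        (real (m k) powr (\<sigma> k)\<^sup>2 * ln (real (m k)) powr (- (((\<sigma> k)\<^sup>2 - 1) / 2))))"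

text \<open>
  A \<open>K\<close>-tuple is a function on \<open>nat\<close> of which only the values on \<open>{1..K}\<close> matter;
  \<open>tuple_limit_in K S v l\<close> says that the tuples \<open>v n\<close> converge to \<open>l\<close> and \<open>l\<close> lies in \<open>S^K\<close>.
\<close>

definition tuple_limit_in ::
    "nat \<Rightarrow> real set \<Rightarrow> (nat \<Rightarrow> nat \<Rightarrow> real) \<Rightarrow> (nat \<Rightarrow> real) \<Rightarrow> bool" where
  "tuple_limit_in K S v l \<longleftrightarrow>
     (\<forall>k \<in> {1..K}. (\<lambda>n. v n k) \<longlonglongrightarrow> l k \<and> l k \<in> S)"

end

theory Submission
  imports Defs "HOL-Real_Asymp.Real_Asymp"
begin

text \<open>
  The group with the largest maximum wins, and the proof turns this into a race of clocks. Choose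
  levels \<open>gumbel_level (n\<^sub>1) y\<close>, decreasing in \<open>y > 0\<close>, such that the first sample has about \<open>y\<close> expected
  exceedances, and let the clock of a group ring by time \<open>y\<close> if the maximum of the group exceeds this
  level. The winner is the group whose clock rings first. A Gaussian density of variance \<open>\<sigma>\<^sup>2\<close> is a
  power \<open>1 / \<sigma>\<^sup>2\<close> of the standard one up to a constant; so the expected number of exceedances in
  group \<open>k\<close> is asymptotically \<open>a\<^sub>n\<^sub>k * y powr (1 / \<sigma>\<^sub>k\<^sup>2)\<close> with an explicit rate \<open>a\<^sub>n\<^sub>k\<close> (\<open>clock_rate\<close>), which is
  identically \<open>1\<close> for the first group. If the rates converge to positive limits \<open>a\<^sub>k\<close>, the clocks
  become independent Weibull clocks with survival functions \<open>exp (- a\<^sub>k * y powr (1 / \<sigma>\<^sub>k\<^sup>2))\<close>, and the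
  winning probabilities converge to the probabilities \<open>race_prob\<close> that a given Weibull clock rings
  first, which is the integral of the theorem. For this limit (\<open>win_prob_tendsto_race_prob\<close>) lower
  bounds suffice, because the limits add up to one; the lower bounds come from cutting the event
  that \<open>k\<close> wins into thin slices according to the winning value.

  On the logarithmic scale the rates and the ratios \<open>\<beta>\<close> determine each other up to a term that
  converges as soon as one of them does (\<open>ln_clock_rate_size_ratio\<close>), and \<open>\<beta>\<^sub>k \<longlonglongrightarrow> C\<^sub>k\<close> corresponds to rates
  tending to \<open>exp (- kappa C\<^sub>k \<sigma>\<^sub>k)\<close>. This gives one direction and the formula for the limit.

  Conversely, let the winning probabilities converge to positive limits. A rate that explodes along a
  subsequence would make the first group lose, a rate that vanishes would make its own group
  lose, so the rates have only positive finite limit points. All of them have first coordinate \<open>1\<close>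
  and the same race probabilities, and these determine the rates (\<open>race_prob_inject\<close>). Hence the rates
  converge, and with them \<open>\<beta>\<close>.

  Finally, Gumbel variables, shifted and scaled as in the theorem, are read as Weibull clocks through
  the levels \<open>- ln y\<close>, so that the limit theorem for a constant sequence identifies their winning
  probabilities with the same integral.
\<close>

section \<open>The race of Weibull clocks\<close>

definition race_survival :: "nat \<Rightarrow> (nat \<Rightarrow> real) \<Rightarrow> (nat \<Rightarrow> real) \<Rightarrow> real \<Rightarrow> real" where
  "race_survival K a b x = exp (- (\<Sum>j = 1..K. a j * x powr b j))"

text \<open>
  Joint density of "clock \<open>k\<close> rings at time \<open>x\<close> and no other clock has rung before", when the clocks are
  independent with survival functions \<open>exp (- a j * x powr b j)\<close>: the hazard rate of clock \<open>k\<close> times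
  the probability that nobody has rung. Its integral \<open>race_prob\<close> is the probability that clock \<open>k\<close>
  rings first.
\<close>

definition race_density ::
    "nat \<Rightarrow> (nat \<Rightarrow> real) \<Rightarrow> (nat \<Rightarrow> real) \<Rightarrow> nat \<Rightarrow> real \<Rightarrow> real" where
  "race_density K a b k x = a k * b k * x powr (b k - 1) * race_survival K a b x"

definition race_prob :: "nat \<Rightarrow> (nat \<Rightarrow> real) \<Rightarrow> (nat \<Rightarrow> real) \<Rightarrow> nat \<Rightarrow> real" where
  "race_prob K a b k = (LINT x:{0<..}|lborel. race_density K a b k x)"

locale weibull_race =
  fixes K :: nat and a b :: "nat \<Rightarrow> real"
  assumes K_pos: "K \<ge> 1"
    and a_pos: "\<And>j. j \<in> {1..K} \<Longrightarrow> a j > 0"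
    and b_pos: "\<And>j. j \<in> {1..K} \<Longrightarrow> b j > 0"
begin

lemma race_density_pos: "k \<in> {1..K} \<Longrightarrow> 0 < x \<Longrightarrow> 0 < race_density K a b k x"
  using a_pos b_pos by (simp add: race_density_def race_survival_def)

lemma race_density_continuous_on: "continuous_on {0<..} (race_density K a b k)"
  unfolding race_density_def race_survival_def by (intro continuous_intros) auto

lemma set_borel_measurable_race_density:
  "set_borel_measurable lborel {0<..} (race_density K a b k)"
  using borel_measurable_continuous_on_indicator[OF _ race_density_continuous_on]
  by (simp add: set_borel_measurable_def)

text \<open>
  Some clock rings first, so the hazards add up to minus the logarithmic derivative of the common survival
  function. This telescopes the winning probabilities to total mass one without evaluating any of
  them.
\<close>

lemma race_survival_deriv:
  assumes "0 < x"
  shows "((\<lambda>x. - race_survival K a b x) has_real_derivative (\<Sum>k = 1..K. race_density K a b k x))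
    (at x)"
proof -
  have "((\<lambda>x. - race_survival K a b x) has_real_derivative
     - (race_survival K a b x * - (\<Sum>k = 1..K. a k * (b k * x powr (b k - 1))))) (at x)"
    unfolding race_survival_def
    using assms by (auto intro!: derivative_eq_intros sum.cong)
  moreover have "- (race_survival K a b x * - (\<Sum>k = 1..K. a k * (b k * x powr (b k - 1))))
      = (\<Sum>k = 1..K. race_density K a b k x)"
    by (simp add: race_density_def sum_distrib_left sum_distrib_right mult_ac)
  ultimately show ?thesis by metis
qed

lemma race_survival_at_0: "(race_survival K a b \<longlongrightarrow> 1) (at_right 0)"
proof -
  have "((\<lambda>x. \<Sum>j = 1..K. a j * x powr b j) \<longlongrightarrow> (\<Sum>j = 1..K. a j * 0)) (at_right 0)"
  proof (intro tendsto_intros)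
    fix j assume "j \<in> {1..K}"
    then have "0 < b j" by (rule b_pos)
    then show "((\<lambda>x. x powr b j) \<longlongrightarrow> 0) (at_right 0)" by real_asymp
  qed
  from tendsto_exp[OF tendsto_minus[OF this]] show ?thesis by (simp add: race_survival_def[abs_def])
qed

lemma race_survival_at_top: "(race_survival K a b \<longlongrightarrow> 0) at_top"
proof -
  have *: "((\<lambda>x. exp (- (a 1 * x powr b 1))) \<longlongrightarrow> 0) at_top"
    using a_pos[of 1] b_pos[of 1] K_pos by simp real_asymp
  have "race_survival K a b x \<le> exp (- (a 1 * x powr b 1))" for x
    unfolding race_survival_def exp_le_cancel_iff neg_le_iff_le using K_pos
    by (intro member_le_sum[of 1 "{1..K}" "\<lambda>j. a j * x powr b j"])
       (auto intro!: mult_nonneg_nonneg less_imp_le[OF a_pos])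
  then show ?thesis
    by (intro tendsto_sandwich[OF _ _ tendsto_const *] always_eventually allI)
       (auto simp: race_survival_def)
qed

lemma total_density:
  shows "set_integrable lborel {0<..} (\<lambda>x. \<Sum>k = 1..K. race_density K a b k x)"
    and "(LINT x:{0<..}|lborel. \<Sum>k = 1..K. race_density K a b k x) = 1"
proof -
  let ?S = "\<lambda>x. \<Sum>k = 1..K. race_density K a b k x"
  have 1: "isCont ?S x" if "0 < x" for x
    using race_density_continuous_on that
    by (intro continuous_intros) (auto simp: continuous_on_eq_continuous_at)
  have 2: "0 \<le> ?S x" if "0 < x" for x
    using race_density_pos that by (intro sum_nonneg less_imp_le) auto
  have 3: "(((\<lambda>x. - race_survival K a b x) \<circ> real_of_ereal) \<longlongrightarrow> - 1) (at_right 0)"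
    using tendsto_minus[OF race_survival_at_0]
    by (simp add: ereal_tendsto_simps zero_ereal_def del: ereal_eq_0)
  have 4: "(((\<lambda>x. - race_survival K a b x) \<circ> real_of_ereal) \<longlongrightarrow> - 0) (at_left \<infinity>)"
    using tendsto_minus[OF race_survival_at_top] by (simp add: ereal_tendsto_simps)
  have e: "einterval 0 \<infinity> = {0<..}" by (auto simp: einterval_def)
  note FTC = interval_integral_FTC_nonneg[of 0 \<infinity>, OF _ race_survival_deriv 1 _ 3 4]
  show "set_integrable lborel {0<..} ?S"
    using FTC(1) 2 by (simp add: e)
  show "(LINT x:{0<..}|lborel. ?S x) = 1"
    using FTC(2) 2 by (simp add: interval_lebesgue_integral_def e)
qed

lemma set_integrable_race_density:
  assumes "k \<in> {1..K}"
  shows "set_integrable lborel {0<..} (race_density K a b k)"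
proof (rule set_integrable_bound[OF total_density(1)])
  show "AE x in lborel. x \<in> {0<..} \<longrightarrow>
      norm (race_density K a b k x) \<le> norm (\<Sum>k = 1..K. race_density K a b k x)"
  proof (intro AE_I2 impI)
    fix x :: real assume "x \<in> {0<..}"
    then have x: "0 < x" by simp
    have "race_density K a b k x \<le> (\<Sum>k = 1..K. race_density K a b k x)"
      using assms race_density_pos[OF _ x] by (intro member_le_sum) (auto intro: less_imp_le)
    then show "norm (race_density K a b k x) \<le> norm (\<Sum>k = 1..K. race_density K a b k x)"
      using race_density_pos[OF assms x] by simp
  qed
qed (use set_borel_measurable_race_density in auto)

lemma sum_race_prob: "(\<Sum>k = 1..K. race_prob K a b k) = 1"
proof -
  have "(LINT x:{0<..}|lborel. \<Sum>k = 1..K. race_density K a b k x)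
      = (\<Sum>k = 1..K. LINT x:{0<..}|lborel. race_density K a b k x)"
    unfolding set_lebesgue_integral_def scaleR_sum_right
    using set_integrable_race_density
    by (intro Bochner_Integration.integral_sum) (auto simp: set_integrable_def)
  then show ?thesis unfolding race_prob_def total_density(2) by (rule sym)
qed

end

lemma set_integral_Ioi_pos:
  fixes f :: "real \<Rightarrow> real"
  assumes int: "set_integrable lborel {0<..} f" and pos: "\<And>x. 0 < x \<Longrightarrow> 0 < f x"
  shows "0 < (LINT x:{0<..}|lborel. f x)"
proof -
  let ?g = "\<lambda>x. indicator {0<..} x *\<^sub>R f x"
  have g: "0 \<le> ?g x" for x
    using pos[of x] by (auto simp: indicator_def less_imp_le)
  have "integral\<^sup>L lborel ?g \<noteq> 0"
  proof
    assume "integral\<^sup>L lborel ?g = 0"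
    then have "AE x in lborel. ?g x = 0"
      using integral_nonneg_eq_0_iff_AE[of lborel ?g] int g by (simp add: set_integrable_def)
    then have "AE x in lborel. x \<notin> {0<..<1::real}"
      by eventually_elim (use pos in \<open>force simp: indicator_def split: if_splits\<close>)
    then have "emeasure lborel {0<..<1::real} = 0"
      by (subst AE_iff_measurable[symmetric, where N="{0<..<1::real}"]) auto
    then show False by simp
  qed
  moreover have "0 \<le> integral\<^sup>L lborel ?g"
    using g by (intro Bochner_Integration.integral_nonneg) auto
  ultimately show ?thesis by (simp add: set_lebesgue_integral_def)
qed

context weibull_race
begin

lemma race_prob_pos: "k \<in> {1..K} \<Longrightarrow> 0 < race_prob K a b k"
  unfolding race_prob_def
  by (intro set_integral_Ioi_pos set_integrable_race_density race_density_pos)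

lemma race_prob_less_1:
  assumes "K \<ge> 2" and k: "k \<in> {1..K}"
  shows "race_prob K a b k < 1"
proof -
  obtain j where j: "j \<in> {1..K}" "j \<noteq> k"
    using assms that[of 1] that[of 2] by (cases "k = 1") auto
  have "race_prob K a b k + race_prob K a b j = (\<Sum>i\<in>{k, j}. race_prob K a b i)"
    using j by simp
  also have "\<dots> \<le> (\<Sum>i = 1..K. race_prob K a b i)"
    using j k race_prob_pos by (intro sum_mono2) (auto intro: less_imp_le)
  finally show ?thesis
    using race_prob_pos[OF j(1)] sum_race_prob by simp
qed

text \<open>
  Running time at another speed does not change the order in which the clocks ring, but it changes
  the rates: the substitution \<open>x \<mapsto> r * x\<close> turns \<open>a j\<close> into \<open>a j * r powr b j\<close>.
\<close>

lemma race_prob_rescale: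
  assumes k: "k \<in> {1..K}" and r: "0 < r"
  shows "race_prob K (\<lambda>j. a j * r powr b j) b k = race_prob K a b k"
proof -
  let ?f = "\<lambda>x. indicator {0<..} x *\<^sub>R race_density K a b k x"
  have "race_prob K a b k = \<bar>r\<bar> *\<^sub>R (LINT x|lborel. ?f (0 + r * x))"
    unfolding race_prob_def set_lebesgue_integral_def
    using r by (intro lborel_integral_real_affine) auto
  also have "\<dots> = (LINT x|lborel. r * ?f (r * x))"
    using r by simp
  also have "\<dots> = (LINT x|lborel. indicator {0<..} x *\<^sub>R race_density K (\<lambda>j. a j * r powr b j) b k x)"
  proof (intro Bochner_Integration.integral_cong refl)
    fix x :: real
    show "r * ?f (r * x) = indicator {0<..} x *\<^sub>R race_density K (\<lambda>j. a j * r powr b j) b k x"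
    proof (cases "0 < x")
      case True
      have "r * r powr (b k - 1) = r powr b k"
        using r by (metis add_diff_cancel_left' diff_add_cancel powr_mult_base less_imp_le add.commute)
      then have "r * (a k * b k * (r powr (b k - 1) * x powr (b k - 1)))
          = a k * r powr b k * b k * x powr (b k - 1)"
        by (metis (no_types, opaque_lifting) mult.assoc mult.left_commute)
      then show ?thesis
        using True r
        by (simp add: race_density_def race_survival_def powr_mult mult.assoc)
    qed (use r in \<open>simp add: zero_less_mult_iff\<close>)
  qed
  finally show ?thesis
    by (simp add: race_prob_def set_lebesgue_integral_def)
qed

end

text \<open>
  Slowing down a rival of clock \<open>k\<close> leaves clock \<open>k\<close> more time to ring first.
\<close>

lemma race_prob_antimono_strict:
  assumes "weibull_race K a b" "weibull_race K a' b"
    and k: "k \<in> {1..K}" and le: "\<And>j. j \<in> {1..K} \<Longrightarrow> a' j \<le> a j" and eq: "a' k = a k"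
    and i: "i \<in> {1..K}" "a' i < a i"
  shows "race_prob K a b k < race_prob K a' b k"
proof -
  interpret A: weibull_race K a b by fact
  interpret A': weibull_race K a' b by fact
  have "race_density K a b k x < race_density K a' b k x" if x: "0 < x" for x
  proof -
    have "(\<Sum>j = 1..K. a' j * x powr b j) < (\<Sum>j = 1..K. a j * x powr b j)"
      using x i le by (intro sum_strict_mono_ex1) (auto intro!: bexI[of _ i])
    then show ?thesis
      using x A.a_pos[OF k] A.b_pos[OF k] by (simp add: race_density_def race_survival_def eq)
  qed
  then have "0 < (LINT x:{0<..}|lborel. race_density K a' b k x - race_density K a b k x)"
    using k A.set_integrable_race_density A'.set_integrable_race_density
    by (intro set_integral_Ioi_pos set_integral_diff) auto
  then show ?thesis
    using k A.set_integrable_race_density A'.set_integrable_race_density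
    by (simp add: race_prob_def set_integral_diff)
qed

text \<open>
  The winning probabilities determine the rates up to a change of speed, and the normalisation of
  the first rate fixes the speed. Choose the speed at which the rates \<open>a\<close> dominate the rates \<open>a'\<close>
  with equality for one clock \<open>k\<close>. If another rate differed, clock \<open>k\<close> would strictly gain by passing
  from the larger rates to the smaller ones, although its winning probability is the same.
\<close>

lemma race_prob_inject:
  assumes "weibull_race K a b" "weibull_race K a' b"
    and eq: "\<And>k. k \<in> {1..K} \<Longrightarrow> race_prob K a b k = race_prob K a' b k"
    and norm: "a 1 = a' 1" and j: "j \<in> {1..K}"
  shows "a j = a' j"
proof -
  interpret A: weibull_race K a b by fact
  interpret A': weibull_race K a' b by fact
  \<comment> \<open>clock \<open>j\<close> acquires the rate \<open>a\' j\<close> when time runs at speed \<open>t j\<close>\<close>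
  define t where "t j = (a' j / a j) powr (1 / b j)" for j
  have t_pos: "0 < t j" if "j \<in> {1..K}" for j
    using that A.a_pos[OF that] A'.a_pos[OF that] by (simp add: t_def)
  have t_powr: "a j * t j powr b j = a' j" if "j \<in> {1..K}" for j
    using that A.a_pos[OF that] A'.a_pos[OF that] A.b_pos[OF that] by (simp add: t_def powr_powr)
  have "Max (t ` {1..K}) \<in> t ` {1..K}"
    using A.K_pos by (intro Max_in) auto
  then obtain k where k: "k \<in> {1..K}" and kmax: "t k = Max (t ` {1..K})" by auto
  have t_le: "t j \<le> t k" if "j \<in> {1..K}" for j
    unfolding kmax using that by auto
  define r where "r = t k"
  have r: "0 < r" using t_pos[OF k] by (simp add: r_def)
  have race: "weibull_race K (\<lambda>j. a j * r powr b j) b"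
    using A.K_pos A.a_pos A.b_pos r by unfold_locales auto
  have le: "a' j \<le> a j * r powr b j" if "j \<in> {1..K}" for j
    using t_le[OF that] t_pos[OF that] A.a_pos[OF that] A.b_pos[OF that] t_powr[OF that, symmetric]
    by (simp add: r_def powr_mono2)
  have all_eq: "a' i = a i * r powr b i" if "i \<in> {1..K}" for i
  proof (rule ccontr)
    assume "a' i \<noteq> a i * r powr b i"
    then have "a' i < a i * r powr b i" using le[OF that] by simp
    from race_prob_antimono_strict[OF race assms(2) k le _ that this]
    have "race_prob K (\<lambda>j. a j * r powr b j) b k < race_prob K a' b k"
      using t_powr[OF k] by (simp add: r_def)
    then show False
      using A.race_prob_rescale[OF k r] eq[OF k] by simp
  qed
  have "r powr b 1 = 1"
    using all_eq[of 1] norm A.K_pos A.a_pos[of 1] by simp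
  then have "r = 1"
    using r A.b_pos[of 1] A.K_pos by (auto simp: powr_def)
  then show ?thesis using all_eq[OF j] by simp
qed

section \<open>Convergence of the winning probabilities\<close>

context weibull_race
begin

definition clock_tail :: "nat \<Rightarrow> real \<Rightarrow> real" where
  "clock_tail k x = exp (- (a k * x powr b k))"

definition rivals_tail :: "nat \<Rightarrow> real \<Rightarrow> real" where
  "rivals_tail k x = (\<Prod>j\<in>{1..K} - {k}. clock_tail j x)"

lemma race_survival_split:
  "k \<in> {1..K} \<Longrightarrow> race_survival K a b x = clock_tail k x * rivals_tail k x"
  unfolding race_survival_def rivals_tail_def clock_tail_def sum_negf[symmetric]
  by (simp add: exp_sum prod.remove)

lemma clock_tail_deriv:
  "0 < x \<Longrightarrow> ((\<lambda>x. - clock_tail k x) has_real_derivative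
     a k * b k * x powr (b k - 1) * clock_tail k x) (at x)"
  unfolding clock_tail_def by (auto intro!: derivative_eq_intros)

lemma clock_tail_antimono: "k \<in> {1..K} \<Longrightarrow> 0 \<le> x \<Longrightarrow> x \<le> y \<Longrightarrow> clock_tail k y \<le> clock_tail k x"
  unfolding clock_tail_def using a_pos b_pos
  by (simp add: less_imp_le powr_mono2)

lemma rivals_tail_antimono: "0 \<le> x \<Longrightarrow> x \<le> y \<Longrightarrow> rivals_tail k y \<le> rivals_tail k x"
  unfolding rivals_tail_def
  by (intro prod_mono conjI clock_tail_antimono) (auto simp: clock_tail_def)

lemma isCont_rivals_tail: "0 < x \<Longrightarrow> isCont (rivals_tail k) x"
  unfolding rivals_tail_def clock_tail_def by (intro continuous_intros) auto

text \<open>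
  On a short interval the rivals' survival function is nearly constant, so this bound of the race
  density's integral is nearly sharp; its right-hand side involves
  the survival functions of the clocks only at the two end points.
\<close>

lemma race_integral_le:
  assumes k: "k \<in> {1..K}" and cd: "0 < c" "c \<le> d"
  shows "(LINT x:{c<..d}|lborel. race_density K a b k x)
    \<le> rivals_tail k c * (clock_tail k c - clock_tail k d)"
proof -
  let ?g = "\<lambda>x. a k * b k * x powr (b k - 1) * clock_tail k x"
  have cont: "continuous_on {c..d} ?g"
    unfolding clock_tail_def using cd by (intro continuous_intros) auto
  have int_g: "integrable lborel (\<lambda>x. indicator {c..d} x *\<^sub>R ?g x)"
    using borel_integrable_atLeastAtMost'[OF cont] by (simp add: set_integrable_def)
  have FTC: "(LINT x|lborel. indicator {c..d} x *\<^sub>R ?g x) = - clock_tail k d - - clock_tail k c"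
  proof (rule integral_FTC_atLeastAtMost[OF cd(2) _ cont])
    fix x assume "c \<le> x" "x \<le> d"
    then have "((\<lambda>x. - clock_tail k x) has_real_derivative ?g x) (at x within {c..d})"
      using clock_tail_deriv[of x k] cd by (simp add: has_field_derivative_at_within)
    then show "((\<lambda>x. - clock_tail k x) has_vector_derivative ?g x) (at x within {c..d})"
      by (simp add: has_real_derivative_iff_has_vector_derivative)
  qed
  have "(LINT x|lborel. indicator {c<..d} x *\<^sub>R race_density K a b k x)
    \<le> (LINT x|lborel. rivals_tail k c * (indicator {c..d} x *\<^sub>R ?g x))"
  proof (rule integral_mono)
    have "set_integrable lborel {c<..d} (race_density K a b k)"
      by (rule set_integrable_subset[OF set_integrable_race_density[OF k]]) (use cd in auto)
    then show "integrable lborel (\<lambda>x. indicator {c<..d} x *\<^sub>R race_density K a b k x)"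
      by (simp add: set_integrable_def)
    show "integrable lborel (\<lambda>x. rivals_tail k c * (indicator {c..d} x *\<^sub>R ?g x))"
      using int_g by (rule integrable_mult_right)
    fix x
    have "race_density K a b k x \<le> rivals_tail k c * ?g x" if "c \<le> x"
    proof -
      have g: "0 \<le> ?g x"
        using a_pos[OF k] b_pos[OF k] by (simp add: clock_tail_def)
      have "race_density K a b k x = rivals_tail k x * ?g x"
        by (simp add: race_density_def race_survival_split[OF k])
      also have "\<dots> \<le> rivals_tail k c * ?g x"
        using g that cd by (intro mult_right_mono rivals_tail_antimono) auto
      finally show ?thesis .
    qed
    moreover have "0 \<le> rivals_tail k c * ?g x"
      using a_pos[OF k] b_pos[OF k]
      by (auto simp: clock_tail_def rivals_tail_def intro!: mult_nonneg_nonneg prod_nonneg)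
    ultimately show "indicator {c<..d} x *\<^sub>R race_density K a b k x
        \<le> rivals_tail k c * (indicator {c..d} x *\<^sub>R ?g x)"
      by (auto simp: indicator_def)
  qed
  then show ?thesis
    using FTC by (simp add: set_lebesgue_integral_def)
qed

lemma race_prob_truncate:
  assumes k: "k \<in> {1..K}" and e: "0 < \<epsilon>"
  obtains s t where "0 < s" "s \<le> t"
    "race_prob K a b k - \<epsilon> \<le> (LINT x:{s<..t}|lborel. race_density K a b k x)"
proof -
  let ?A = "\<lambda>i::nat. {1 / (real i + 1)<..real i + 1}"
  have U: "(\<Union>i. ?A i) = {0<..}"
  proof (intro equalityI subsetI)
    fix x :: real assume x: "x \<in> {0<..}"
    obtain i :: nat where i: "max x (1 / x) < real i"
      using reals_Archimedean2 by blast
    then have "1 / x < real i + 1" "x \<le> real i + 1" by auto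
    then have "x \<in> ?A i"
      using x by (simp add: field_simps)
    then show "x \<in> (\<Union>i. ?A i)" by blast
  next
    fix x :: real assume "x \<in> (\<Union>i. ?A i)"
    then obtain i where "1 / (real i + 1) < x" by auto
    moreover have "0 < 1 / (real i + 1)" by simp
    ultimately have "0 < x" by linarith
    then show "x \<in> {0<..}" by simp
  qed
  have "incseq ?A"
  proof (rule incseq_SucI)
    fix i
    have "1 / (real (Suc i) + 1) \<le> 1 / (real i + 1)" by (intro divide_left_mono) auto
    then show "?A i \<subseteq> ?A (Suc i)" by auto
  qed
  then have "(\<lambda>i. LINT x:?A i|lborel. race_density K a b k x)
      \<longlonglongrightarrow> (LINT x:(\<Union>i. ?A i)|lborel. race_density K a b k x)"
    using set_integrable_race_density[OF k] unfolding U[symmetric]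
    by (intro set_integral_cont_up) auto
  then have "eventually (\<lambda>i. race_prob K a b k - \<epsilon> < (LINT x:?A i|lborel. race_density K a b k x))
      sequentially"
    unfolding U race_prob_def using e by (intro order_tendstoD) auto
  then obtain i where "race_prob K a b k - \<epsilon> < (LINT x:?A i|lborel. race_density K a b k x)"
    by (auto simp: eventually_sequentially)
  then show ?thesis
    by (intro that[of "1 / (real i + 1)" "real i + 1"]) (auto simp: field_simps)
qed

end

context prob_space
begin

lemma win_event_measurable:
  fixes Y :: "nat \<Rightarrow> 'a \<Rightarrow> real"
  assumes Y: "\<And>j. j \<in> {1..K} \<Longrightarrow> Y j \<in> borel_measurable M" and k: "k \<in> {1..K}"
  shows "{\<omega> \<in> space M. \<forall>j \<in> {1..K} - {k}. Y k \<omega> > Y j \<omega>} \<in> events"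
proof (intro sets.sets_Collect_finite_All)
  fix j assume "j \<in> {1..K} - {k}"
  with Y k have [measurable]: "Y j \<in> borel_measurable M" "Y k \<in> borel_measurable M" by auto
  then show "{\<omega> \<in> space M. Y k \<omega> > Y j \<omega>} \<in> events" by (rule borel_measurable_less)
qed simp

lemma sum_win_prob_le_1:
  assumes Y: "\<And>j. j \<in> {1..K} \<Longrightarrow> Y j \<in> borel_measurable M"
  shows "(\<Sum>k = 1..K. win_prob M K Y k) \<le> 1"
proof -
  let ?A = "\<lambda>k. {\<omega> \<in> space M. \<forall>j \<in> {1..K} - {k}. Y k \<omega> > Y j \<omega>}"
  have "prob (\<Union>k\<in>{1..K}. ?A k) = (\<Sum>k = 1..K. prob (?A k))"
  proof (rule finite_measure_finite_Union)
    show "?A ` {1..K} \<subseteq> events"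
      using win_event_measurable[of K Y, OF Y] by blast
    show "disjoint_family_on ?A {1..K}"
      unfolding disjoint_family_on_def
    proof (intro ballI impI equals0I)
      fix k l \<omega> assume "k \<in> {1..K}" "l \<in> {1..K}" "k \<noteq> l" "\<omega> \<in> ?A k \<inter> ?A l"
      then have "Y l \<omega> < Y k \<omega>" "Y k \<omega> < Y l \<omega>" by auto
      then show False by simp
    qed
  qed simp
  then show ?thesis
    unfolding win_prob_def by (metis prob_le_1)
qed

lemma win_prob_two_player_bound:
  assumes Y: "\<And>j. j \<in> {1..K} \<Longrightarrow> Y j \<in> borel_measurable M"
    and k: "k \<in> {1..K}" and j: "j \<in> {1..K}" "j \<noteq> k"
  shows "win_prob M K Y k \<le> 1 - prob {\<omega> \<in> space M. Y k \<omega> \<le> u} + prob {\<omega> \<in> space M. Y j \<omega> \<le> u}"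
proof -
  note [measurable] = Y[OF k] Y[OF j(1)]
  have "win_prob M K Y k
      \<le> prob ((space M - {\<omega> \<in> space M. Y k \<omega> \<le> u}) \<union> {\<omega> \<in> space M. Y j \<omega> \<le> u})"
    unfolding win_prob_def
  proof (rule finite_measure_mono)
    show "{\<omega> \<in> space M. \<forall>j \<in> {1..K} - {k}. Y k \<omega> > Y j \<omega>}
        \<subseteq> (space M - {\<omega> \<in> space M. Y k \<omega> \<le> u}) \<union> {\<omega> \<in> space M. Y j \<omega> \<le> u}"
    proof
      fix \<omega> assume "\<omega> \<in> {\<omega> \<in> space M. \<forall>j \<in> {1..K} - {k}. Y k \<omega> > Y j \<omega>}"
      then have "\<omega> \<in> space M" "Y j \<omega> < Y k \<omega>" using j by auto
      then show "\<omega> \<in> (space M - {\<omega> \<in> space M. Y k \<omega> \<le> u}) \<union> {\<omega> \<in> space M. Y j \<omega> \<le> u}"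
        by (cases "Y k \<omega> \<le> u") auto
    qed
  qed measurable
  also have "\<dots> \<le> prob (space M - {\<omega> \<in> space M. Y k \<omega> \<le> u}) + prob {\<omega> \<in> space M. Y j \<omega> \<le> u}"
    by (intro measure_Un_le) auto
  also have "prob (space M - {\<omega> \<in> space M. Y k \<omega> \<le> u}) = 1 - prob {\<omega> \<in> space M. Y k \<omega> \<le> u}"
    by (intro prob_compl) auto
  finally show ?thesis .
qed

text \<open>
  Cutting the event of winning into slices by the winning value makes it accessible to distribution functions at finitely many levels.
\<close>

definition slice :: "nat \<Rightarrow> (nat \<Rightarrow> 'a \<Rightarrow> real) \<Rightarrow> nat \<Rightarrow> real \<Rightarrow> real \<Rightarrow> 'a set" where
  "slice K Y k v w = {\<omega> \<in> space M. (\<forall>j \<in> {1..K} - {k}. Y k \<omega> > Y j \<omega>) \<and> v < Y k \<omega> \<and> Y k \<omega> \<le> w}"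

lemma slice_measurable:
  assumes Y: "\<And>j. j \<in> {1..K} \<Longrightarrow> Y j \<in> borel_measurable M" and k: "k \<in> {1..K}"
  shows "slice K Y k v w \<in> events"
proof -
  note [measurable] = Y[OF k]
  have "slice K Y k v w = {\<omega> \<in> space M. \<forall>j \<in> {1..K} - {k}. Y k \<omega> > Y j \<omega>}
      \<inter> {\<omega> \<in> space M. v < Y k \<omega> \<and> Y k \<omega> \<le> w}"
    by (auto simp: slice_def)
  then show ?thesis
    using win_event_measurable[OF Y k] by simp
qed

text \<open>
  Player \<open>k\<close> certainly wins if it ends up in the slice while all others stay below its lower end;
  by independence this has a product probability.
\<close>

lemma prob_slice_ge:
  assumes indep: "indep_vars (\<lambda>_. borel) Y {1..K}" and k: "k \<in> {1..K}" and vw: "v \<le> w"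
  shows "(prob {\<omega> \<in> space M. Y k \<omega> \<le> w} - prob {\<omega> \<in> space M. Y k \<omega> \<le> v})
      * (\<Prod>j\<in>{1..K} - {k}. prob {\<omega> \<in> space M. Y j \<omega> \<le> v}) \<le> prob (slice K Y k v w)"
proof -
  have Y: "Y j \<in> borel_measurable M" if "j \<in> {1..K}" for j
    using indep that by (auto simp: indep_vars_def)
  note [measurable] = Y[OF k]
  define A where "A j = (if j = k then {v<..w} else {..v})" for j
  have ev: "Y j -` {..x} \<inter> space M = {\<omega> \<in> space M. Y j \<omega> \<le> x}" for j x by auto
  have "prob (\<Inter>j\<in>{1..K}. Y j -` A j \<inter> space M) = (\<Prod>j\<in>{1..K}. prob (Y j -` A j \<inter> space M))"
    by (rule indep_varsD[OF indep]) (use k in \<open>auto simp: A_def\<close>)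
  also have "\<dots> = prob (Y k -` A k \<inter> space M) * (\<Prod>j\<in>{1..K} - {k}. prob (Y j -` A j \<inter> space M))"
    using k by (simp add: prod.remove)
  also have "Y k -` A k \<inter> space M = {\<omega> \<in> space M. Y k \<omega> \<le> w} - {\<omega> \<in> space M. Y k \<omega> \<le> v}"
    by (auto simp: A_def)
  also have "prob \<dots> = prob {\<omega> \<in> space M. Y k \<omega> \<le> w} - prob {\<omega> \<in> space M. Y k \<omega> \<le> v}"
    using vw by (intro finite_measure_Diff) auto
  also have "(\<Prod>j\<in>{1..K} - {k}. prob (Y j -` A j \<inter> space M))
      = (\<Prod>j\<in>{1..K} - {k}. prob {\<omega> \<in> space M. Y j \<omega> \<le> v})"
    by (intro prod.cong) (auto simp: A_def ev)
  finally have "(prob {\<omega> \<in> space M. Y k \<omega> \<le> w} - prob {\<omega> \<in> space M. Y k \<omega> \<le> v})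
      * (\<Prod>j\<in>{1..K} - {k}. prob {\<omega> \<in> space M. Y j \<omega> \<le> v})
      = prob (\<Inter>j\<in>{1..K}. Y j -` A j \<inter> space M)" by simp
  also have "\<dots> \<le> prob (slice K Y k v w)"
  proof (intro finite_measure_mono slice_measurable Y k)
    show "(\<Inter>j\<in>{1..K}. Y j -` A j \<inter> space M) \<subseteq> slice K Y k v w"
    proof
      fix \<omega> assume \<omega>: "\<omega> \<in> (\<Inter>j\<in>{1..K}. Y j -` A j \<inter> space M)"
      then have "\<omega> \<in> space M" "v < Y k \<omega>" "Y k \<omega> \<le> w"
        using k by (auto simp: A_def split: if_splits)
      moreover have "Y j \<omega> \<le> v" if "j \<in> {1..K} - {k}" for j
        using INT_D[OF \<omega>, of j] that by (simp add: A_def)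
      ultimately show "\<omega> \<in> slice K Y k v w"
        by (force simp: slice_def)
    qed
  qed
  finally show ?thesis .
qed

lemma prob_slice_superadditive:
  assumes Y: "\<And>j. j \<in> {1..K} \<Longrightarrow> Y j \<in> borel_measurable M" and k: "k \<in> {1..K}"
    and "v \<le> w" "w \<le> z"
  shows "prob (slice K Y k v w) + prob (slice K Y k w z) \<le> prob (slice K Y k v z)"
proof -
  have "prob (slice K Y k v w) + prob (slice K Y k w z) = prob (slice K Y k v w \<union> slice K Y k w z)"
    using slice_measurable[OF Y k]
    by (intro finite_measure_Union[symmetric]) (auto simp: slice_def)
  also have "\<dots> \<le> prob (slice K Y k v z)"
    using assms slice_measurable[OF Y k] by (intro finite_measure_mono) (auto simp: slice_def)
  finally show ?thesis .
qed

lemma prob_slice_le_win_prob: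
  assumes "\<And>j. j \<in> {1..K} \<Longrightarrow> Y j \<in> borel_measurable M" "k \<in> {1..K}"
  shows "prob (slice K Y k v w) \<le> win_prob M K Y k"
  unfolding win_prob_def slice_def
  by (rule finite_measure_mono[OF _ win_event_measurable[OF assms]]) auto

end

text \<open>
  Here the players with the largest value win. A decreasing level function \<open>u n\<close> reads values as
  times: a player rings by time \<open>y\<close> if its value exceeds \<open>u n y\<close>, so that the largest value belongs
  to the first clock to ring. The assumption \<open>level_limit\<close> says that the clocks read off in this way
  are asymptotically Weibull clocks.
\<close>

locale weibull_race_limit = weibull_race +
  fixes M :: "nat \<Rightarrow> 'a measure" and Y :: "nat \<Rightarrow> nat \<Rightarrow> 'a \<Rightarrow> real"
    and u :: "nat \<Rightarrow> real \<Rightarrow> real"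
  assumes prob: "\<And>n. prob_space (M n)"
    and indep: "\<And>n. prob_space.indep_vars (M n) (\<lambda>_. borel) (Y n) {1..K}"
    and level_antimono: "\<And>n y z. 0 < y \<Longrightarrow> y \<le> z \<Longrightarrow> u n z \<le> u n y"
    and level_limit: "\<And>j y. j \<in> {1..K} \<Longrightarrow> 0 < y \<Longrightarrow>
      (\<lambda>n. measure (M n) {\<omega> \<in> space (M n). Y n j \<omega> \<le> u n y}) \<longlonglongrightarrow> exp (- (a j * y powr b j))"
begin

lemma Y_measurable: "j \<in> {1..K} \<Longrightarrow> Y n j \<in> borel_measurable (M n)"
  using indep[of n] by (auto simp: prob_space.indep_vars_def[OF prob])

text \<open>
  Both sides are additive over adjacent time intervals (the right one at least superadditive), and
  the error term \<open>\<epsilon> * (clock_tail k s - clock_tail k t)\<close> is chosen to be additive as well.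
  By Bolzano's principle it is therefore enough to prove the claim for intervals so short that the
  rivals' survival function varies by less than \<open>\<epsilon>\<close>, and there \<open>race_integral_le\<close> and
  \<open>prob_slice_ge\<close> differ by no more than that error.
\<close>

lemma slice_liminf_ge:
  assumes k: "k \<in> {1..K}" and e: "0 < \<epsilon>" and st: "0 < s" "s \<le> t" and eta: "0 < \<eta>"
  shows "eventually (\<lambda>n. (LINT x:{s<..t}|lborel. race_density K a b k x)
      - \<epsilon> * (clock_tail k s - clock_tail k t) - \<eta>
      \<le> measure (M n) (prob_space.slice (M n) K (Y n) k (u n t) (u n s))) sequentially"
proof -
  define I where "I c d = (LINT x:{c<..d}|lborel. race_density K a b k x)" for c d
  define P where "P c d \<longleftrightarrow> (0 < c \<longrightarrow> c \<le> d \<longrightarrow> (\<forall>\<eta>>0. eventually (\<lambda>n.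
      I c d - \<epsilon> * (clock_tail k c - clock_tail k d) - \<eta>
      \<le> measure (M n) (prob_space.slice (M n) K (Y n) k (u n d) (u n c))) sequentially))" for c d
  from st(2) have "P s t"
  proof (induction s t rule: Bolzano)
    case (trans c d e)
    show ?case
      unfolding P_def
    proof (intro impI allI)
      fix \<eta> :: real assume c: "0 < c" "c \<le> e" and "0 < \<eta>"
      then have "0 < \<eta> / 2" by simp
      with trans c have
        1: "eventually (\<lambda>n. I c d - \<epsilon> * (clock_tail k c - clock_tail k d) - \<eta> / 2
          \<le> measure (M n) (prob_space.slice (M n) K (Y n) k (u n d) (u n c))) sequentially" and
        2: "eventually (\<lambda>n. I d e - \<epsilon> * (clock_tail k d - clock_tail k e) - \<eta> / 2
          \<le> measure (M n) (prob_space.slice (M n) K (Y n) k (u n e) (u n d))) sequentially"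
        unfolding P_def by auto
      have I: "I c e = I c d + I d e"
      proof -
        have "{c<..e} = {c<..d} \<union> {d<..e}" using trans by auto
        moreover have "set_integrable lborel {c<..d} (race_density K a b k)"
            "set_integrable lborel {d<..e} (race_density K a b k)"
          by (rule set_integrable_subset[OF set_integrable_race_density[OF k]];
              use c trans in auto)+
        ultimately show ?thesis
          unfolding I_def by (auto intro: set_integral_Un)
      qed
      have "measure (M n) (prob_space.slice (M n) K (Y n) k (u n d) (u n c))
          + measure (M n) (prob_space.slice (M n) K (Y n) k (u n e) (u n d))
          \<le> measure (M n) (prob_space.slice (M n) K (Y n) k (u n e) (u n c))" (is "?super n") for n
        using prob_space.prob_slice_superadditive[OF prob[of n], of K "Y n", OF Y_measurable k,
            of "u n e" "u n d" "u n c"] level_antimono c trans by (auto simp: add.commute)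
      then have "eventually ?super sequentially" by simp
      with 1 2 show "eventually (\<lambda>n. I c e - \<epsilon> * (clock_tail k c - clock_tail k e) - \<eta>
          \<le> measure (M n) (prob_space.slice (M n) K (Y n) k (u n e) (u n c))) sequentially"
      proof eventually_elim
        case (elim n)
        then show ?case by (simp add: I algebra_simps)
      qed
    qed
  next
    case (local x)
    then have x: "0 < x" using st by simp
    obtain \<delta> where \<delta>: "0 < \<delta>"
        "\<And>y. \<bar>y - x\<bar> < \<delta> \<Longrightarrow> \<bar>rivals_tail k y - rivals_tail k x\<bar> < \<epsilon> / 2"
      using isCont_rivals_tail[OF x, of k] e half_gt_zero[OF e]
      unfolding continuous_at_eps_delta dist_real_def by metis
    show ?case
    proof (intro exI[of _ \<delta>] conjI \<delta>(1) allI impI; elim conjE)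
      fix c d assume cd: "c \<le> x" "x \<le> d" "d - c < \<delta>"
      show "P c d"
        unfolding P_def
      proof (intro impI allI)
        fix \<eta> :: real assume c: "0 < c" "c \<le> d" and eta: "0 < \<eta>"
        have close: "rivals_tail k c \<le> rivals_tail k d + \<epsilon>"
        proof -
          have "\<bar>rivals_tail k c - rivals_tail k x\<bar> < \<epsilon> / 2" "\<bar>rivals_tail k d - rivals_tail k x\<bar> < \<epsilon> / 2"
            by (rule \<delta>(2); use cd in linarith)+
          then show ?thesis by (simp add: abs_if split: if_splits)
        qed
        have "I c d \<le> rivals_tail k c * (clock_tail k c - clock_tail k d)"
          unfolding I_def by (rule race_integral_le[OF k c])
        also have "\<dots> \<le> (rivals_tail k d + \<epsilon>) * (clock_tail k c - clock_tail k d)"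
          using close clock_tail_antimono[OF k, of c d] c by (intro mult_right_mono) auto
        finally have I_le: "I c d - \<epsilon> * (clock_tail k c - clock_tail k d)
            \<le> (clock_tail k c - clock_tail k d) * rivals_tail k d"
          by (simp add: algebra_simps)
        let ?F = "\<lambda>n j y. measure (M n) {\<omega> \<in> space (M n). Y n j \<omega> \<le> u n y}"
        have "(\<lambda>n. (?F n k c - ?F n k d) * (\<Prod>j\<in>{1..K} - {k}. ?F n j d))
            \<longlonglongrightarrow> (clock_tail k c - clock_tail k d) * rivals_tail k d"
          unfolding rivals_tail_def clock_tail_def using c k
          by (intro tendsto_mult tendsto_diff tendsto_prod level_limit) auto
        then have "eventually (\<lambda>n. (clock_tail k c - clock_tail k d) * rivals_tail k d - \<eta>
            < (?F n k c - ?F n k d) * (\<Prod>j\<in>{1..K} - {k}. ?F n j d)) sequentially"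
          using eta by (intro order_tendstoD) auto
        then show "eventually (\<lambda>n. I c d - \<epsilon> * (clock_tail k c - clock_tail k d) - \<eta>
            \<le> measure (M n) (prob_space.slice (M n) K (Y n) k (u n d) (u n c))) sequentially"
        proof eventually_elim
          case (elim n)
          have "(?F n k c - ?F n k d) * (\<Prod>j\<in>{1..K} - {k}. ?F n j d)
              \<le> measure (M n) (prob_space.slice (M n) K (Y n) k (u n d) (u n c))"
            by (rule prob_space.prob_slice_ge[OF prob indep k level_antimono]) (use c in auto)
          with elim I_le show ?case by linarith
        qed
      qed
    qed
  qed
  then show ?thesis
    using st eta by (simp add: P_def I_def)
qed

lemma win_prob_liminf_ge:
  assumes k: "k \<in> {1..K}" and e: "0 < \<epsilon>"
  shows "eventually (\<lambda>n. race_prob K a b k - \<epsilon> \<le> win_prob (M n) K (Y n) k) sequentially"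
proof -
  obtain s t where st: "0 < s" "s \<le> t"
    and le: "race_prob K a b k - \<epsilon> / 3 \<le> (LINT x:{s<..t}|lborel. race_density K a b k x)"
    using race_prob_truncate[OF k, of "\<epsilon> / 3"] e by auto
  have "clock_tail k s - clock_tail k t \<le> 1"
    using a_pos[OF k] by (simp add: clock_tail_def) (smt (verit) exp_ge_zero exp_le_one_iff mult_nonneg_nonneg powr_ge_zero)
  then have small: "\<epsilon> / 3 * (clock_tail k s - clock_tail k t) \<le> \<epsilon> / 3"
    using e by (intro mult_left_le) auto
  have "eventually (\<lambda>n. (LINT x:{s<..t}|lborel. race_density K a b k x)
      - \<epsilon> / 3 * (clock_tail k s - clock_tail k t) - \<epsilon> / 3
      \<le> measure (M n) (prob_space.slice (M n) K (Y n) k (u n t) (u n s))) sequentially"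
    by (rule slice_liminf_ge[OF k _ st]) (use e in auto)
  then show ?thesis
  proof eventually_elim
    case (elim n)
    have "measure (M n) (prob_space.slice (M n) K (Y n) k (u n t) (u n s))
        \<le> win_prob (M n) K (Y n) k"
      by (rule prob_space.prob_slice_le_win_prob[OF prob Y_measurable k])
    with elim le small show ?case by linarith
  qed
qed

text \<open>
  Asymptotic lower bounds suffice: the winning probabilities add up to at most one, their claimed
  limits add up to exactly one, so no player can exceed its limit while the others reach theirs.
\<close>

lemma win_prob_tendsto_race_prob:
  assumes k: "k \<in> {1..K}"
  shows "(\<lambda>n. win_prob (M n) K (Y n) k) \<longlonglongrightarrow> race_prob K a b k"
  unfolding tendsto_iff
proof (intro allI impI)
  fix \<epsilon> :: real assume e: "0 < \<epsilon>"
  \<comment> \<open>each of the at most \<open>K - 1\<close> rivals may fall short of its limit by \<open>\<delta>\<close>\<close>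
  define \<delta> where "\<delta> = \<epsilon> / (real K + 1)"
  have \<delta>: "0 < \<delta>" "real K * \<delta> < \<epsilon>"
    using e by (auto simp: \<delta>_def field_simps)
  have "eventually (\<lambda>n. \<forall>j\<in>{1..K}. race_prob K a b j - \<delta> \<le> win_prob (M n) K (Y n) j) sequentially"
    using win_prob_liminf_ge \<delta> by (intro eventually_ball_finite) auto
  then show "eventually (\<lambda>n. dist (win_prob (M n) K (Y n) k) (race_prob K a b k) < \<epsilon>) sequentially"
  proof eventually_elim
    case (elim n)
    let ?w = "win_prob (M n) K (Y n)"
    have "(\<Sum>j\<in>{1..K} - {k}. race_prob K a b j - \<delta>) \<le> (\<Sum>j\<in>{1..K} - {k}. ?w j)"
      using elim by (intro sum_mono) auto
    moreover have "(\<Sum>j\<in>{1..K} - {k}. race_prob K a b j - \<delta>)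
        = (\<Sum>j\<in>{1..K} - {k}. race_prob K a b j) - real (K - 1) * \<delta>"
      using k by (simp add: sum_subtractf)
    moreover have "?w k + (\<Sum>j\<in>{1..K} - {k}. ?w j) \<le> 1"
      using prob_space.sum_win_prob_le_1[of "M n" K "Y n", OF prob Y_measurable]
        sum.remove[of "{1..K}" k ?w] k by simp
    moreover have "race_prob K a b k + (\<Sum>j\<in>{1..K} - {k}. race_prob K a b j) = 1"
      using sum_race_prob sum.remove[of "{1..K}" k "race_prob K a b"] k by simp
    moreover have "real (K - 1) * \<delta> \<le> real K * \<delta>" "\<delta> \<le> real K * \<delta>"
      using \<delta>(1) K_pos by (auto intro: mult_right_mono)
    moreover have "race_prob K a b k - \<delta> \<le> ?w k"
      using elim k by blast
    ultimately show ?case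
      using \<delta> unfolding dist_real_def abs_less_iff by linarith
  qed
qed

end

section \<open>Maxima of Gaussian samples\<close>

definition normal_tail :: "real \<Rightarrow> real \<Rightarrow> real" where
  "normal_tail s u = measure (density lborel (normal_density 0 s)) {u<..}"

text \<open>
  The leading term of the Gaussian tail at infinity.
\<close>

definition mills_tail :: "real \<Rightarrow> real \<Rightarrow> real" where
  "mills_tail s u = s\<^sup>2 / u * normal_density 0 s u"

lemma normal_density_0_deriv:
  "s > 0 \<Longrightarrow> (normal_density 0 s has_real_derivative - (x / s\<^sup>2 * normal_density 0 s x)) (at x)"
  unfolding normal_density_def[abs_def]
  by (auto intro!: derivative_eq_intros simp: field_simps power2_eq_square)

text \<open>
  The derivative of \<open>- mills_tail s\<close> is \<open>(1 + s\<^sup>2 / x\<^sup>2) * normal_density 0 s x\<close>. Hence \<open>mills_tail s u\<close>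
  is the integral of the density over the tail with a weight between \<open>1\<close> and \<open>1 + s\<^sup>2 / u\<^sup>2\<close>.
\<close>

lemma normal_tail_mills_bounds:
  assumes s: "s > 0" and u: "u > 0"
  shows "normal_tail s u \<le> mills_tail s u"
    and "mills_tail s u \<le> (1 + s\<^sup>2 / u\<^sup>2) * normal_tail s u"
proof -
  let ?\<phi> = "normal_density 0 s"
  let ?H = "\<lambda>x. (1 + s\<^sup>2 / x\<^sup>2) * ?\<phi> x"
  interpret prob_space "density lborel ?\<phi>"
    by (rule prob_space_normal_density[OF s])
  have "AE x in lborel. x \<noteq> u" by (rule AE_lborel_singleton)
  then have "emeasure (density lborel ?\<phi>) {u<..} = (\<integral>\<^sup>+x. ennreal (?\<phi> x) * indicator {u..} x \<partial>lborel)"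
    by (subst emeasure_density)
       (auto intro!: nn_integral_cong_AE elim!: eventually_mono simp: indicator_def)
  then have tail: "ennreal (normal_tail s u) = (\<integral>\<^sup>+x. ennreal (?\<phi> x) * indicator {u..} x \<partial>lborel)"
    by (simp add: normal_tail_def emeasure_eq_measure)
  have "(\<integral>\<^sup>+x. ennreal (?H x) * indicator {u..} x \<partial>lborel) = ennreal (0 - - mills_tail s u)"
  proof (rule nn_integral_FTC_atLeast)
    fix x assume "u \<le> x"
    then have x: "0 < x" using u by simp
    show "((\<lambda>x. - mills_tail s x) has_real_derivative ?H x) (at x)"
      unfolding mills_tail_def using x s
      by (auto intro!: derivative_eq_intros normal_density_0_deriv simp: field_simps power2_eq_square)
    show "0 \<le> ?H x" by (simp add: normal_density_nonneg)
  next
    have "((\<lambda>x. s\<^sup>2 / x * (1 / sqrt (2 * pi * s\<^sup>2))) \<longlongrightarrow> 0) at_top"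
      by real_asymp
    moreover have "eventually (\<lambda>x. norm (- mills_tail s x) \<le> s\<^sup>2 / x * (1 / sqrt (2 * pi * s\<^sup>2))) at_top"
      using eventually_gt_at_top[of 0]
    proof eventually_elim
      case (elim x)
      have "?\<phi> x \<le> 1 / sqrt (2 * pi * s\<^sup>2)"
        unfolding normal_density_def by (intro mult_left_le) auto
      then have "s\<^sup>2 / x * ?\<phi> x \<le> s\<^sup>2 / x * (1 / sqrt (2 * pi * s\<^sup>2))"
        using elim by (intro mult_left_mono) auto
      moreover have "norm (- mills_tail s x) = s\<^sup>2 / x * ?\<phi> x"
        using elim normal_density_nonneg[of 0 s x] by (simp add: mills_tail_def)
      ultimately show ?case by simp
    qed
    ultimately show "((\<lambda>x. - mills_tail s x) \<longlongrightarrow> 0) at_top"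
      by (rule Lim_null_comparison[rotated])
  qed measurable
  then have mills: "(\<integral>\<^sup>+x. ennreal (?H x) * indicator {u..} x \<partial>lborel) = ennreal (mills_tail s u)"
    by simp
  have nonneg: "0 \<le> mills_tail s u" "0 \<le> normal_tail s u"
    using u normal_density_nonneg[of 0 s u] by (auto simp: mills_tail_def normal_tail_def)
  have "ennreal (normal_tail s u) \<le> ennreal (mills_tail s u)"
    unfolding tail mills[symmetric]
    by (intro nn_integral_mono mult_right_mono ennreal_leI)
       (auto simp: algebra_simps normal_density_nonneg)
  then show "normal_tail s u \<le> mills_tail s u"
    using nonneg by simp
  have "ennreal (mills_tail s u)
      \<le> (\<integral>\<^sup>+x. ennreal (1 + s\<^sup>2 / u\<^sup>2) * (ennreal (?\<phi> x) * indicator {u..} x) \<partial>lborel)"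
    unfolding mills[symmetric]
  proof (rule nn_integral_mono)
    fix x
    have "?H x \<le> (1 + s\<^sup>2 / u\<^sup>2) * ?\<phi> x" if "u \<le> x"
      using that u normal_density_nonneg[of 0 s x]
      by (intro mult_right_mono add_left_mono divide_left_mono power_mono) auto
    then show "ennreal (?H x) * indicator {u..} x
        \<le> ennreal (1 + s\<^sup>2 / u\<^sup>2) * (ennreal (?\<phi> x) * indicator {u..} x)"
      by (auto simp: indicator_def ennreal_mult[symmetric] normal_density_nonneg
          simp del: ennreal_plus intro!: ennreal_leI)
  qed
  also have "\<dots> = ennreal (1 + s\<^sup>2 / u\<^sup>2) * ennreal (normal_tail s u)"
    unfolding tail by (rule nn_integral_cmult) measurable
  also have "\<dots> = ennreal ((1 + s\<^sup>2 / u\<^sup>2) * normal_tail s u)"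
    using nonneg by (simp add: ennreal_mult)
  finally show "mills_tail s u \<le> (1 + s\<^sup>2 / u\<^sup>2) * normal_tail s u"
    using nonneg by simp
qed

lemma normal_tail_asymp:
  assumes s: "s > 0"
  shows "((\<lambda>u. normal_tail s u / mills_tail s u) \<longlongrightarrow> 1) at_top"
proof (rule tendsto_sandwich)
  show "eventually (\<lambda>u. 1 / (1 + s\<^sup>2 / u\<^sup>2) \<le> normal_tail s u / mills_tail s u) at_top"
    using eventually_gt_at_top[of 0]
  proof eventually_elim
    case (elim u)
    have "0 < mills_tail s u"
      using elim s normal_density_pos[OF s] by (simp add: mills_tail_def)
    moreover have "0 < 1 + s\<^sup>2 / u\<^sup>2" by (simp add: add_pos_nonneg)
    ultimately show ?case
      using normal_tail_mills_bounds(2)[OF s elim] by (simp add: field_simps)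
  qed
  show "eventually (\<lambda>u. normal_tail s u / mills_tail s u \<le> 1) at_top"
    using eventually_gt_at_top[of 0]
  proof eventually_elim
    case (elim u)
    have "0 < mills_tail s u"
      using elim s normal_density_pos[OF s] by (simp add: mills_tail_def)
    then show ?case
      using normal_tail_mills_bounds(1)[OF s elim] by simp
  qed
  show "((\<lambda>u. 1 / (1 + s\<^sup>2 / u\<^sup>2)) \<longlongrightarrow> 1) at_top" by real_asymp
qed simp

lemma (in prob_space) prob_normal_le:
  assumes X: "distributed M lborel X (normal_density 0 s)" and s: "s > 0"
  shows "prob {\<omega> \<in> space M. X \<omega> \<le> u} = 1 - normal_tail s u"
proof -
  have [measurable]: "X \<in> borel_measurable M"
    using distributed_measurable[OF X] by simp
  have "normal_tail s u = measure (distr M lborel X) {u<..}"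
    by (simp add: normal_tail_def distributed_distr_eq_density[OF X])
  also have "\<dots> = prob (space M - {\<omega> \<in> space M. X \<omega> \<le> u})"
    by (subst measure_distr) (auto intro!: arg_cong[where f=prob])
  also have "\<dots> = 1 - prob {\<omega> \<in> space M. X \<omega> \<le> u}"
    by (intro prob_compl) auto
  finally show ?thesis by simp
qed

lemma (in prob_space) prob_sample_max_le:
  assumes indep: "indep_vars (\<lambda>_. borel) X {1..m}" and m: "m > 0"
    and q: "\<And>i. i \<in> {1..m} \<Longrightarrow> prob {\<omega> \<in> space M. X i \<omega> \<le> u} = q"
  shows "prob {\<omega> \<in> space M. sample_max X m \<omega> \<le> u} = q ^ m"
proof -
  have "{\<omega> \<in> space M. sample_max X m \<omega> \<le> u} = (\<Inter>i\<in>{1..m}. X i -` {..u} \<inter> space M)"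
    using m by (auto simp: sample_max_def)
  also have "prob \<dots> = (\<Prod>i\<in>{1..m}. prob (X i -` {..u} \<inter> space M))"
    by (rule indep_varsD[OF indep]) (use m in auto)
  also have "\<dots> = (\<Prod>i\<in>{1..m}. q)"
    by (intro prod.cong refl) (auto simp: q[symmetric] intro!: arg_cong[where f=prob])
  finally show ?thesis by simp
qed

lemma Poisson_limit:
  fixes q :: "nat \<Rightarrow> real" and v :: "nat \<Rightarrow> nat"
  assumes q: "\<And>n. 0 \<le> q n" and v: "filterlim v at_top sequentially"
    and lim: "(\<lambda>n. real (v n) * q n) \<longlonglongrightarrow> c"
  shows "(\<lambda>n. (1 - q n) ^ v n) \<longlonglongrightarrow> exp (- c)"
proof -
  have v': "filterlim (\<lambda>n. real (v n)) at_top sequentially"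
    using filterlim_compose[OF filterlim_real_sequentially v] .
  have "(\<lambda>n. real (v n) * q n / real (v n)) \<longlonglongrightarrow> 0"
    by (rule real_tendsto_divide_at_top[OF lim v'])
  moreover have "eventually (\<lambda>n. real (v n) * q n / real (v n) = q n) sequentially"
    using filterlim_at_top_dense[THEN iffD1, OF v', rule_format, of 0] by eventually_elim simp
  ultimately have q0: "q \<longlonglongrightarrow> 0"
    by (rule Lim_transform_eventually)
  have small: "eventually (\<lambda>n. q n < 1 / 2) sequentially"
    using order_tendstoD(2)[OF q0, of "1/2"] by simp
  \<comment> \<open>sandwich with \<open>- q - 2 * q\<^sup>2 \<le> ln (1 - q) \<le> - q\<close>; valid for small \<open>q\<close>; the quadratic term is negligible since \<open>q \<longlonglongrightarrow> 0\<close>\<close>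
  have "(\<lambda>n. real (v n) * ln (1 - q n)) \<longlonglongrightarrow> - c"
  proof (rule tendsto_sandwich)
    show "eventually (\<lambda>n. - (real (v n) * q n) - 2 * (real (v n) * q n) * q n
        \<le> real (v n) * ln (1 - q n)) sequentially"
      using small
    proof eventually_elim
      case (elim n)
      have "real (v n) * (- q n - 2 * (q n)\<^sup>2) \<le> real (v n) * ln (1 - q n)"
        using elim q[of n] by (intro mult_left_mono ln_one_minus_pos_lower_bound) auto
      then show ?case by (simp add: algebra_simps power2_eq_square)
    qed
    show "eventually (\<lambda>n. real (v n) * ln (1 - q n) \<le> - (real (v n) * q n)) sequentially"
      using small
    proof eventually_elim
      case (elim n)
      have "real (v n) * ln (1 - q n) \<le> real (v n) * - q n"
        using elim ln_le_minus_one[of "1 - q n"] by (intro mult_left_mono) auto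
      then show ?case by simp
    qed
    have "(\<lambda>n. - (real (v n) * q n) - 2 * (real (v n) * q n) * q n) \<longlonglongrightarrow> - c - 2 * c * 0"
      by (intro tendsto_intros lim q0)
    then show "(\<lambda>n. - (real (v n) * q n) - 2 * (real (v n) * q n) * q n) \<longlonglongrightarrow> - c" by simp
    show "(\<lambda>n. - (real (v n) * q n)) \<longlonglongrightarrow> - c" by (intro tendsto_intros lim)
  qed
  then have "(\<lambda>n. exp (real (v n) * ln (1 - q n))) \<longlonglongrightarrow> exp (- c)"
    by (rule tendsto_exp)
  moreover have "eventually (\<lambda>n. exp (real (v n) * ln (1 - q n)) = (1 - q n) ^ v n) sequentially"
    using small by eventually_elim (simp add: exp_of_nat_mult)
  ultimately show ?thesis by (rule Lim_transform_eventually)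
qed

lemma Poisson_limit_infinite:
  fixes q :: "nat \<Rightarrow> real" and v :: "nat \<Rightarrow> nat"
  assumes q: "\<And>n. q n \<le> 1"
    and lim: "filterlim (\<lambda>n. real (v n) * q n) at_top sequentially"
  shows "(\<lambda>n. (1 - q n) ^ v n) \<longlonglongrightarrow> 0"
proof (rule tendsto_sandwich)
  show "eventually (\<lambda>n. 0 \<le> (1 - q n) ^ v n) sequentially" using q by simp
  show "eventually (\<lambda>n. (1 - q n) ^ v n \<le> exp (- (real (v n) * q n))) sequentially"
  proof (intro always_eventually allI)
    fix n
    have "(1 - q n) ^ v n \<le> exp (- q n) ^ v n"
      using q[of n] exp_ge_add_one_self[of "- q n"] by (intro power_mono) auto
    then show "(1 - q n) ^ v n \<le> exp (- (real (v n) * q n))"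
      by (simp add: exp_of_nat_mult[symmetric])
  qed
  show "(\<lambda>n. exp (- (real (v n) * q n))) \<longlonglongrightarrow> 0"
    using filterlim_compose[OF exp_at_bot filterlim_compose[OF filterlim_uminus_at_bot_at_top lim]] .
qed simp

text \<open>
  The square of the level is adjusted so that a standard Gaussian sample of size \<open>m\<close> has
  asymptotically \<open>y\<close> exceedances in the mean. With this choice the sample of the first group becomes
  a clock of rate \<open>1\<close> and shape \<open>1\<close>.
\<close>

definition gumbel_level :: "nat \<Rightarrow> real \<Rightarrow> real" where
  "gumbel_level m y = sqrt (2 * ln m - ln (ln m) - ln (4 * pi) - 2 * ln y)"

text \<open>
  The coefficient of \<open>y powr (1 / s\<^sup>2)\<close> in the expected number of exceedances of \<open>gumbel_level m y\<close> in a
  sample of size \<open>v\<close> with standard deviation \<open>s\<close>. The power appears because the density with standard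
  deviation \<open>s\<close> is, up to a constant, the standard density raised to the power \<open>1 / s\<^sup>2\<close>.
\<close>

definition clock_rate :: "real \<Rightarrow> nat \<Rightarrow> nat \<Rightarrow> real" where
  "clock_rate s m v = exp (ln s - (1 - 1 / s\<^sup>2) / 2 * ln (4 * pi) + ln v
     - ln m / s\<^sup>2 - (1 - 1 / s\<^sup>2) / 2 * ln (ln m))"

lemma clock_rate_1: "0 < m \<Longrightarrow> clock_rate 1 m m = 1"
  by (simp add: clock_rate_def)

lemma gumbel_level_antimono: "0 < y \<Longrightarrow> y \<le> z \<Longrightarrow> gumbel_level m z \<le> gumbel_level m y"
  by (simp add: gumbel_level_def)

lemma ln_nat_at_top: "filterlim (\<lambda>m::nat. ln (real m)) at_top sequentially"
  by real_asymp

lemma gumbel_level_at_top: "filterlim (\<lambda>m. gumbel_level m y) at_top sequentially"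
  unfolding gumbel_level_def by real_asymp

lemma gumbel_level_asymp: "(\<lambda>m. sqrt (2 * ln (real m)) / gumbel_level m y) \<longlonglongrightarrow> 1"
  unfolding gumbel_level_def by real_asymp

text \<open>
  With the leading term in place of the tail, the dependence on \<open>y\<close> and on the sizes separates exactly,
  except for a factor that tends to \<open>1\<close>.
\<close>

lemma expected_exceedances:
  assumes s: "s > 0" and y: "y > 0" and v: "v > 0" and L: "0 < ln (real m)"
    and u: "0 < gumbel_level m y"
  shows "real v * mills_tail s (gumbel_level m y)
    = clock_rate s m v * y powr (1 / s\<^sup>2) * (sqrt (2 * ln m) / gumbel_level m y)"
proof -
  let ?L = "ln (real m)" and ?u = "gumbel_level m y"
  define b where "b = 1 / s\<^sup>2"
  have u2: "?u\<^sup>2 = 2 * ?L - ln ?L - ln (4 * pi) - 2 * ln y"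
    using u unfolding gumbel_level_def by (metis less_le real_sqrt_gt_0_iff real_sqrt_pow2)
  have ln4: "ln (4 * pi) = 2 * ln 2 + ln pi" 
    using ln_realpow[of 2 2] by (simp add: ln_mult)
  have sq: "sqrt x = exp (ln x / 2)" if "0 < x" for x :: real
    using that by (simp add: powr_half_sqrt[symmetric] powr_def)
  have "real v * mills_tail s ?u
      = exp (ln v) * exp (ln s) * exp (- ln ?u) * exp (- ln (2 * pi) / 2) * exp (- b / 2 * ?u\<^sup>2)"
    using s v u
    by (simp add: mills_tail_def normal_density_def b_def exp_minus sq[symmetric] real_sqrt_mult
        field_simps power2_eq_square)
  also have "\<dots> = exp (ln v + ln s - ln ?u - ln (2 * pi) / 2 - b / 2 * ?u\<^sup>2)"
    by (simp add: exp_add[symmetric])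
  also have "ln v + ln s - ln ?u - ln (2 * pi) / 2 - b / 2 * ?u\<^sup>2
      = (ln s - (1 - b) / 2 * ln (4 * pi) + ln v - b * ?L - (1 - b) / 2 * ln ?L)
        + b * ln y + ln (2 * ?L) / 2 - ln ?u"
    unfolding u2 ln4 using L by (simp add: ln_mult field_simps)
  also have "exp \<dots> = clock_rate s m v * y powr (1 / s\<^sup>2) * (sqrt (2 * ?L) / ?u)"
    using y u L by (simp add: clock_rate_def b_def exp_add exp_diff powr_def sq)
  finally show ?thesis .
qed

lemma exceedances_asymp:
  fixes m v :: "nat \<Rightarrow> nat"
  assumes s: "s > 0" and y: "y > 0"
    and m: "filterlim m at_top sequentially" and v: "\<And>n. v n > 0"
  shows "(\<lambda>n. real (v n) * normal_tail s (gumbel_level (m n) y)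
    / (clock_rate s (m n) (v n) * y powr (1 / s\<^sup>2))) \<longlonglongrightarrow> 1"
proof -
  let ?u = "\<lambda>n. gumbel_level (m n) y"
  have u: "filterlim ?u at_top sequentially"
    by (rule filterlim_compose[OF gumbel_level_at_top m])
  have L: "filterlim (\<lambda>n. ln (real (m n))) at_top sequentially"
    by (rule filterlim_compose[OF ln_nat_at_top m])
  have "(\<lambda>n. normal_tail s (?u n) / mills_tail s (?u n) * (sqrt (2 * ln (real (m n))) / ?u n)) \<longlonglongrightarrow> 1 * 1"
    by (intro tendsto_mult filterlim_compose[OF normal_tail_asymp[OF s] u]
        filterlim_compose[OF gumbel_level_asymp m])
  moreover have "eventually (\<lambda>n. 0 < ?u n) sequentially" "eventually (\<lambda>n. 0 < ln (real (m n))) sequentially"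
    using u L by (auto simp: filterlim_at_top_dense)
  then have "eventually (\<lambda>n. normal_tail s (?u n) / mills_tail s (?u n) * (sqrt (2 * ln (real (m n))) / ?u n)
      = real (v n) * normal_tail s (?u n) / (clock_rate s (m n) (v n) * y powr (1 / s\<^sup>2))) sequentially"
  proof eventually_elim
    case (elim n)
    let ?r = "clock_rate s (m n) (v n) * y powr (1 / s\<^sup>2)" and ?S = "sqrt (2 * ln (real (m n))) / ?u n"
    have "0 < mills_tail s (?u n)"
      using elim s normal_density_pos[OF s] by (simp add: mills_tail_def)
    moreover have r: "0 < ?r"
      using y by (simp add: clock_rate_def)
    have "?S = real (v n) * mills_tail s (?u n) / ?r"
      unfolding expected_exceedances[OF s y v elim(2,1)]
      by (rule nonzero_mult_div_cancel_left[OF less_imp_neq[OF r, symmetric], symmetric])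
    ultimately show ?case
      by simp
  qed
  ultimately show ?thesis
    by (auto elim: Lim_transform_eventually)
qed

lemma normal_tail_range: "s > 0 \<Longrightarrow> 0 \<le> normal_tail s u \<and> normal_tail s u \<le> 1"
  using prob_space.prob_le_1[OF prob_space_normal_density] by (simp add: normal_tail_def)

text \<open>
  The limit rate \<open>a\<close> may be \<open>0\<close>: the sample then stays below every level, its clock never rings.
\<close>

lemma max_cdf_limit:
  fixes m v :: "nat \<Rightarrow> nat"
  assumes s: "s > 0" and y: "y > 0"
    and m: "filterlim m at_top sequentially" and v: "\<And>n. v n > 0" "filterlim v at_top sequentially"
    and rate: "(\<lambda>n. clock_rate s (m n) (v n)) \<longlonglongrightarrow> a"
  shows "(\<lambda>n. (1 - normal_tail s (gumbel_level (m n) y)) ^ v n) \<longlonglongrightarrow> exp (- (a * y powr (1 / s\<^sup>2)))"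
proof (rule Poisson_limit[OF _ v(2)])
  let ?r = "\<lambda>n. clock_rate s (m n) (v n) * y powr (1 / s\<^sup>2)"
  have "(\<lambda>n. real (v n) * normal_tail s (gumbel_level (m n) y) / ?r n * ?r n)
      \<longlonglongrightarrow> 1 * (a * y powr (1 / s\<^sup>2))"
    by (intro tendsto_mult exceedances_asymp s y m v(1) rate tendsto_const)
  moreover have "?r n \<noteq> 0" for n using y by (simp add: clock_rate_def)
  ultimately show "(\<lambda>n. real (v n) * normal_tail s (gumbel_level (m n) y)) \<longlonglongrightarrow> a * y powr (1 / s\<^sup>2)"
    by simp
qed (use normal_tail_range[OF s] in auto)

lemma max_cdf_limit_infinite:
  fixes m v :: "nat \<Rightarrow> nat"
  assumes s: "s > 0" and y: "y > 0"
    and m: "filterlim m at_top sequentially" and v: "\<And>n. v n > 0"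
    and rate: "filterlim (\<lambda>n. clock_rate s (m n) (v n)) at_top sequentially"
  shows "(\<lambda>n. (1 - normal_tail s (gumbel_level (m n) y)) ^ v n) \<longlonglongrightarrow> 0"
proof (rule Poisson_limit_infinite)
  let ?r = "\<lambda>n. clock_rate s (m n) (v n) * y powr (1 / s\<^sup>2)"
  have "filterlim ?r at_top sequentially"
    using y by (intro filterlim_at_top_mult_tendsto_pos[OF tendsto_const _ rate]) auto
  then have "filterlim (\<lambda>n. real (v n) * normal_tail s (gumbel_level (m n) y) / ?r n * ?r n) at_top sequentially"
    by (intro filterlim_tendsto_pos_mult_at_top[OF exceedances_asymp[OF s y m v]]) auto
  moreover have "?r n \<noteq> 0" for n using y by (simp add: clock_rate_def)
  ultimately show "filterlim (\<lambda>n. real (v n) * normal_tail s (gumbel_level (m n) y)) at_top sequentially"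
    by simp
qed (use normal_tail_range[OF s] in auto)

section \<open>Clock rates and sample size ratios\<close>

text \<open>
  A relation \<open>y \<approx> c * x + d * ln x\<close> between diverging sequences fixes their ratio. It is applied to the
  logarithms of the two sample sizes, in both roles.
\<close>

lemma log_ratio_limit:
  fixes x y :: "nat \<Rightarrow> real"
  assumes x: "filterlim x at_top sequentially"
    and lim: "(\<lambda>n. y n - c * x n - d * ln (x n)) \<longlonglongrightarrow> l"
  shows "(\<lambda>n. y n / x n) \<longlonglongrightarrow> c"
proof -
  have "((\<lambda>t. ln t / t) \<longlongrightarrow> (0::real)) at_top" by real_asymp
  then have "(\<lambda>n. ln (x n) / x n) \<longlonglongrightarrow> 0" by (rule filterlim_compose[OF _ x])
  then have "(\<lambda>n. (y n - c * x n - d * ln (x n)) / x n + c + d * (ln (x n) / x n)) \<longlonglongrightarrow> 0 + c + d * 0"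
    by (intro tendsto_intros real_tendsto_divide_at_top[OF lim x])
  moreover have "eventually (\<lambda>n. (y n - c * x n - d * ln (x n)) / x n + c + d * (ln (x n) / x n)
      = y n / x n) sequentially"
    using filterlim_at_top_dense[THEN iffD1, OF x, rule_format, of 0]
    by eventually_elim (simp add: field_simps)
  ultimately show ?thesis by (auto elim: Lim_transform_eventually)
qed

text \<open>
  The ratio \<open>beta_ratio\<close> of a group other than the first, as a function of the two sample sizes.
\<close>

definition size_ratio :: "real \<Rightarrow> nat \<Rightarrow> nat \<Rightarrow> real" where
  "size_ratio s m v = real m / (real v powr s\<^sup>2 * ln (real v) powr (- ((s\<^sup>2 - 1) / 2)))"

lemma size_ratio_pos: "0 < m \<Longrightarrow> 0 < ln (real v) \<Longrightarrow> 0 < size_ratio s m v"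
  by (cases "v = 0") (simp_all add: size_ratio_def)

lemma ln_size_ratio:
  assumes "0 < m" "0 < v" "0 < ln (real v)"
  shows "ln (size_ratio s m v) = ln m - s\<^sup>2 * ln v + (s\<^sup>2 - 1) / 2 * ln (ln v)"
  using assms by (simp add: size_ratio_def ln_div ln_mult ln_powr)

text \<open>
  The rate and the size ratio differ by an affine map on the logarithmic scale and by the term
  \<open>ln (ln m / ln v)\<close>. If one of them converges to a positive limit, then
  \<open>ln m / ln v\<close> tends to \<open>s\<^sup>2\<close>, and so the other one converges too.
\<close>

lemma ln_clock_rate_size_ratio:
  assumes s: "s > 0" and "0 < m" "0 < v" and L: "0 < ln (real m)" "0 < ln (real v)"
  shows "ln (clock_rate s m v) = ln s - (1 - 1 / s\<^sup>2) / 2 * ln (4 * pi)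
    - ln (size_ratio s m v) / s\<^sup>2 - (1 - 1 / s\<^sup>2) / 2 * ln (ln m / ln v)"
proof -
  define b where "b = 1 / s\<^sup>2"
  have b: "s\<^sup>2 * b = 1" using s by (simp add: b_def)
  have div_b: "x / s\<^sup>2 = x * b" for x by (simp add: b_def)
  have "(ln m - s\<^sup>2 * ln v + (s\<^sup>2 - 1) / 2 * ln (ln v)) * b
      = ln m * b - (s\<^sup>2 * b) * ln v + (s\<^sup>2 * b - b) / 2 * ln (ln v)"
    by (simp add: algebra_simps)
  then have e1: "ln (size_ratio s m v) * b = ln m * b - ln v + (1 - b) / 2 * ln (ln v)"
    unfolding ln_size_ratio[OF assms(2,3) L(2)] b by simp
  have e2: "ln (ln m / ln v) = ln (ln m) - ln (ln v)"
    using L by (simp add: ln_div)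
  show ?thesis
    unfolding clock_rate_def ln_exp div_b e1 e2 by (simp add: field_simps)
qed

context
  fixes s :: real and m v :: "nat \<Rightarrow> nat"
  assumes s: "s > 0"
    and m_lim: "filterlim m at_top sequentially" and v_lim: "filterlim v at_top sequentially"
begin

lemma ln_m_lim: "filterlim (\<lambda>n. ln (real (m n))) at_top sequentially"
  by (rule filterlim_compose[OF ln_nat_at_top m_lim])

lemma ln_v_lim: "filterlim (\<lambda>n. ln (real (v n))) at_top sequentially"
  by (rule filterlim_compose[OF ln_nat_at_top v_lim])

lemma eventually_large:
  "eventually (\<lambda>n. 0 < m n \<and> 0 < v n \<and> 0 < ln (real (m n)) \<and> 0 < ln (real (v n))) sequentially"
proof -
  have "eventually (\<lambda>n. 0 < ln (real (m n))) sequentially" "eventually (\<lambda>n. 0 < ln (real (v n))) sequentially"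
    using ln_m_lim ln_v_lim by (auto simp: filterlim_at_top_dense)
  then show ?thesis by eventually_elim (auto intro!: Nat.gr0I)
qed

text \<open>
  The constants of \<open>kappa\<close> are those of \<open>clock_rate\<close>, together with the limit \<open>s\<^sup>2\<close> of \<open>ln m / ln v\<close>.
\<close>

lemma clock_rate_limit_of_size_ratio:
  assumes C: "C > 0" and lim: "(\<lambda>n. size_ratio s (m n) (v n)) \<longlonglongrightarrow> C"
  shows "(\<lambda>n. clock_rate s (m n) (v n)) \<longlonglongrightarrow> exp (- kappa C s)"
proof -
  have lnlim: "(\<lambda>n. ln (size_ratio s (m n) (v n))) \<longlonglongrightarrow> ln C"
    using C by (intro tendsto_ln lim) auto
  have "eventually (\<lambda>n. ln (size_ratio s (m n) (v n)) = ln (real (m n)) - s\<^sup>2 * ln (real (v n))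
      - ((1 - s\<^sup>2) / 2) * ln (ln (real (v n)))) sequentially"
    using eventually_large by eventually_elim (simp add: ln_size_ratio field_simps)
  with lnlim have "(\<lambda>n. ln (real (m n)) - s\<^sup>2 * ln (real (v n))
      - ((1 - s\<^sup>2) / 2) * ln (ln (real (v n)))) \<longlonglongrightarrow> ln C"
    by (rule Lim_transform_eventually)
  then have ratio: "(\<lambda>n. ln (real (m n)) / ln (real (v n))) \<longlonglongrightarrow> s\<^sup>2"
    by (rule log_ratio_limit[OF ln_v_lim])
  have "(\<lambda>n. ln s - (1 - 1 / s\<^sup>2) / 2 * ln (4 * pi) - ln (size_ratio s (m n) (v n)) / s\<^sup>2
      - (1 - 1 / s\<^sup>2) / 2 * ln (ln (real (m n)) / ln (real (v n))))
    \<longlonglongrightarrow> ln s - (1 - 1 / s\<^sup>2) / 2 * ln (4 * pi) - ln C / s\<^sup>2 - (1 - 1 / s\<^sup>2) / 2 * ln (s\<^sup>2)"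
    using s by (intro lnlim ratio tendsto_intros) auto
  moreover have "eventually (\<lambda>n. ln s - (1 - 1 / s\<^sup>2) / 2 * ln (4 * pi) - ln (size_ratio s (m n) (v n)) / s\<^sup>2
      - (1 - 1 / s\<^sup>2) / 2 * ln (ln (real (m n)) / ln (real (v n))) = ln (clock_rate s (m n) (v n))) sequentially"
    using eventually_large by eventually_elim (simp add: ln_clock_rate_size_ratio[OF s])
  ultimately have "(\<lambda>n. ln (clock_rate s (m n) (v n)))
      \<longlonglongrightarrow> ln s - (1 - 1 / s\<^sup>2) / 2 * ln (4 * pi) - ln C / s\<^sup>2 - (1 - 1 / s\<^sup>2) / 2 * ln (s\<^sup>2)"
    by (rule Lim_transform_eventually)
  also have "ln s - (1 - 1 / s\<^sup>2) / 2 * ln (4 * pi) - ln C / s\<^sup>2 - (1 - 1 / s\<^sup>2) / 2 * ln (s\<^sup>2)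
      = - kappa C s"
    using s C by (simp add: kappa_def ln_div ln_realpow field_simps)
  finally have "(\<lambda>n. exp (ln (clock_rate s (m n) (v n)))) \<longlonglongrightarrow> exp (- kappa C s)"
    by (rule tendsto_exp)
  then show ?thesis by (simp add: clock_rate_def)
qed

lemma size_ratio_limit_of_clock_rate:
  assumes a: "a > 0" and lim: "(\<lambda>n. clock_rate s (m n) (v n)) \<longlonglongrightarrow> a"
  obtains C where "C > 0" "(\<lambda>n. size_ratio s (m n) (v n)) \<longlonglongrightarrow> C"
proof -
  let ?c = "ln s - (1 - 1 / s\<^sup>2) / 2 * ln (4 * pi)"
  have lnlim: "(\<lambda>n. ln (clock_rate s (m n) (v n))) \<longlonglongrightarrow> ln a"
    using a by (intro tendsto_ln lim) auto
  then have "(\<lambda>n. ln (clock_rate s (m n) (v n)) - ?c) \<longlonglongrightarrow> ln a - ?c"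
    by (intro tendsto_diff tendsto_const)
  also have "(\<lambda>n. ln (clock_rate s (m n) (v n)) - ?c) = (\<lambda>n. ln (real (v n)) - 1 / s\<^sup>2 * ln (real (m n))
      - (1 - 1 / s\<^sup>2) / 2 * ln (ln (real (m n))))"
    by (simp add: clock_rate_def fun_eq_iff)
  finally have "(\<lambda>n. ln (real (v n)) / ln (real (m n))) \<longlonglongrightarrow> 1 / s\<^sup>2"
    by (rule log_ratio_limit[OF ln_m_lim])
  then have "(\<lambda>n. inverse (ln (real (v n)) / ln (real (m n)))) \<longlonglongrightarrow> inverse (1 / s\<^sup>2)"
    using s by (intro tendsto_inverse) auto
  then have ratio: "(\<lambda>n. ln (real (m n)) / ln (real (v n))) \<longlonglongrightarrow> s\<^sup>2"
    by simp
  define l where "l = s\<^sup>2 * (?c - ln a - (1 - 1 / s\<^sup>2) / 2 * ln (s\<^sup>2))"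
  have "(\<lambda>n. s\<^sup>2 * (?c - ln (clock_rate s (m n) (v n))
      - (1 - 1 / s\<^sup>2) / 2 * ln (ln (real (m n)) / ln (real (v n))))) \<longlonglongrightarrow> l"
    unfolding l_def using s by (intro lnlim ratio tendsto_intros) auto
  then have "(\<lambda>n. exp (s\<^sup>2 * (?c - ln (clock_rate s (m n) (v n))
      - (1 - 1 / s\<^sup>2) / 2 * ln (ln (real (m n)) / ln (real (v n)))))) \<longlonglongrightarrow> exp l"
    by (rule tendsto_exp)
  moreover have "eventually (\<lambda>n. exp (s\<^sup>2 * (?c - ln (clock_rate s (m n) (v n))
      - (1 - 1 / s\<^sup>2) / 2 * ln (ln (real (m n)) / ln (real (v n))))) = size_ratio s (m n) (v n)) sequentially"
    using eventually_large
  proof eventually_elim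
    case (elim n)
    then have "s\<^sup>2 * (?c - ln (clock_rate s (m n) (v n))
        - (1 - 1 / s\<^sup>2) / 2 * ln (ln (real (m n)) / ln (real (v n)))) = ln (size_ratio s (m n) (v n))"
      using s by (simp add: ln_clock_rate_size_ratio[OF s])
    then show ?case
      using size_ratio_pos[of "m n" "v n" s] elim by simp
  qed
  ultimately have "(\<lambda>n. size_ratio s (m n) (v n)) \<longlonglongrightarrow> exp l"
    by (rule Lim_transform_eventually)
  then show ?thesis by (intro that[of "exp l"]) auto
qed

end

section \<open>The race between Gaussian samples\<close>

lemma LIMSEQ_if_subsubseq:
  fixes x :: "nat \<Rightarrow> 'a :: metric_space"
  assumes sub: "\<And>r :: nat \<Rightarrow> nat. strict_mono r \<Longrightarrow> \<exists>t :: nat \<Rightarrow> nat. strict_mono t \<and> (\<lambda>n. x (r (t n))) \<longlonglongrightarrow> l"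
  shows "x \<longlonglongrightarrow> l"
proof (rule ccontr)
  assume "\<not> x \<longlonglongrightarrow> l"
  then obtain e where e: "e > 0" "\<not> eventually (\<lambda>n. dist (x n) l < e) sequentially"
    by (auto simp: tendsto_iff)
  from e(2) have "infinite {n. \<not> dist (x n) l < e}"
    by (simp only: not_eventually cofinite_eq_sequentially[symmetric] frequently_cofinite
        not_False_eq_True)
  from infinite_enumerate[OF this] obtain r :: "nat \<Rightarrow> nat" where "strict_mono r"
    and r: "\<And>n. \<not> dist (x (r n)) l < e"
    by auto
  from sub[OF this(1)] obtain t :: "nat \<Rightarrow> nat" where "(\<lambda>n. x (r (t n))) \<longlonglongrightarrow> l"
    by auto
  then have "eventually (\<lambda>n. dist (x (r (t n))) l < e) sequentially"
    using e(1) by (simp add: tendsto_iff)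
  then show False using r by simp
qed

lemma finite_family_convergent_subseq:
  fixes x :: "'i \<Rightarrow> nat \<Rightarrow> 'a :: {complete_linorder, linorder_topology}"
  assumes "finite I"
  obtains r l where "strict_mono r" "\<And>i. i \<in> I \<Longrightarrow> (\<lambda>n. x i (r n)) \<longlonglongrightarrow> l i"
  using assms
proof (induction I arbitrary: thesis rule: finite_induct)
  case empty
  show ?case by (rule empty[of id]) (auto simp: strict_mono_def)
next
  case (insert i I)
  obtain r l where r: "strict_mono r" "\<And>j. j \<in> I \<Longrightarrow> (\<lambda>n. x j (r n)) \<longlonglongrightarrow> l j"
    using insert.IH by blast
  obtain li t where t: "strict_mono t" "((\<lambda>n. x i (r n)) \<circ> t) \<longlonglongrightarrow> li"
    using compact_complete_linorder[of "\<lambda>n. x i (r n)"] by blast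
  show ?case
  proof (rule insert.prems[of "r \<circ> t" "\<lambda>j. if j = i then li else l j"])
    show "strict_mono (r \<circ> t)" using r(1) t(1) by (rule strict_mono_o)
    fix j assume "j \<in> insert i I"
    then show "(\<lambda>n. x j ((r \<circ> t) n)) \<longlonglongrightarrow> (if j = i then li else l j)"
      using t r(2)[of j] LIMSEQ_subseq_LIMSEQ[of "\<lambda>n. x j (r n)" _ t]
      by (auto simp: comp_def)
  qed
qed

locale gaussian_race =
  fixes K :: nat and \<sigma> :: "nat \<Rightarrow> real" and N :: "nat \<Rightarrow> nat \<Rightarrow> nat"
    and M :: "nat \<Rightarrow> 'a measure" and X :: "nat \<Rightarrow> nat \<Rightarrow> nat \<Rightarrow> 'a \<Rightarrow> real"
  assumes K_ge_1: "K \<ge> 1"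
    and sigma_1: "\<sigma> 1 = 1"
    and sigma_pos: "\<And>k. k \<in> {1..K} \<Longrightarrow> \<sigma> k > 0"
    and N_pos: "\<And>n k. k \<in> {1..K} \<Longrightarrow> N n k > 0"
    and N_lim: "\<And>k. k \<in> {1..K} \<Longrightarrow> filterlim (\<lambda>n. N n k) at_top sequentially"
    and prob: "\<And>n. prob_space (M n)"
    and normal: "\<And>n k i. k \<in> {1..K} \<Longrightarrow> i \<in> {1..N n k} \<Longrightarrow>
          distributed (M n) lborel (X n k i) (normal_density 0 (\<sigma> k))"
    and indep_within: "\<And>n k. k \<in> {1..K} \<Longrightarrow>
          prob_space.indep_vars (M n) (\<lambda>_. borel) (X n k) {1..N n k}"
    and indep_across: "\<And>n.
          prob_space.indep_vars (M n) (\<lambda>k. Pi\<^sub>M {1..N n k} (\<lambda>_. borel))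
            (\<lambda>k \<omega>. \<lambda>i \<in> {1..N n k}. X n k i \<omega>) {1..K}"
begin

definition group_max :: "nat \<Rightarrow> nat \<Rightarrow> 'a \<Rightarrow> real" where
  "group_max n k = sample_max (X n k) (N n k)"

text \<open>
  The rates are measured against the first group, whose own rate is therefore \<open>1\<close>.
\<close>

definition rate :: "nat \<Rightarrow> nat \<Rightarrow> real" where
  "rate n k = clock_rate (\<sigma> k) (N n 1) (N n k)"

definition shape :: "nat \<Rightarrow> real" where
  "shape k = 1 / (\<sigma> k)\<^sup>2"

lemma subseq:
  fixes r :: "nat \<Rightarrow> nat"
  assumes "strict_mono r"
  shows "gaussian_race K \<sigma> (\<lambda>n. N (r n)) (\<lambda>n. M (r n)) (\<lambda>n. X (r n))"
proof (rule gaussian_race.intro)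
  fix k assume "k \<in> {1..K}"
  from filterlim_compose[OF N_lim[OF this] filterlim_subseq[OF assms]]
  show "filterlim (\<lambda>n. N (r n) k) at_top sequentially" .
qed (fact K_ge_1 sigma_1 sigma_pos N_pos prob normal indep_within indep_across)+

lemma one_in: "1 \<in> {1..K}"
  using K_ge_1 by simp

lemma N1_lim: "filterlim (\<lambda>n. N n 1) at_top sequentially"
  using N_lim[OF one_in] .

lemma rate_pos: "rate n k > 0"
  by (simp add: rate_def clock_rate_def)

lemma rate_1: "rate n 1 = 1"
  using N_pos[OF one_in, of n] sigma_1 clock_rate_1 by (simp add: rate_def)

lemma shape_pos: "k \<in> {1..K} \<Longrightarrow> shape k > 0"
  using sigma_pos[of k] by (simp add: shape_def)

lemma indep_group_max: "prob_space.indep_vars (M n) (\<lambda>_. borel) (group_max n) {1..K}"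
proof -
  interpret prob_space "M n" by (rule prob)
  have "indep_vars (\<lambda>_. borel)
      (\<lambda>k \<omega>. Max ((\<lambda>i. (\<lambda>i\<in>{1..N n k}. X n k i \<omega>) i) ` {1..N n k})) {1..K}"
    by (rule indep_vars_compose2[OF indep_across, of "\<lambda>k v. Max ((\<lambda>i. v i) ` {1..N n k})"])
       (intro borel_measurable_Max measurable_component_singleton; simp)
  moreover have "(\<lambda>k \<omega>. Max ((\<lambda>i. (\<lambda>i\<in>{1..N n k}. X n k i \<omega>) i) ` {1..N n k})) = group_max n"
    by (auto simp: fun_eq_iff group_max_def sample_max_def intro!: arg_cong[where f=Max])
  ultimately show ?thesis by simp
qed

lemma group_max_measurable: "k \<in> {1..K} \<Longrightarrow> group_max n k \<in> borel_measurable (M n)"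
  using indep_group_max[of n] by (auto simp: prob_space.indep_vars_def[OF prob])

lemma prob_group_max_le:
  assumes k: "k \<in> {1..K}"
  shows "measure (M n) {\<omega> \<in> space (M n). group_max n k \<omega> \<le> u} = (1 - normal_tail (\<sigma> k) u) ^ N n k"
  unfolding group_max_def
  by (rule prob_space.prob_sample_max_le[OF prob indep_within[OF k] N_pos[OF k]])
     (rule prob_space.prob_normal_le[OF prob normal[OF k] sigma_pos[OF k]])

lemma group_max_limit:
  assumes k: "k \<in> {1..K}" and y: "y > 0" and "(\<lambda>n. rate n k) \<longlonglongrightarrow> a"
  shows "(\<lambda>n. measure (M n) {\<omega> \<in> space (M n). group_max n k \<omega> \<le> gumbel_level (N n 1) y})
    \<longlonglongrightarrow> exp (- (a * y powr shape k))"
  unfolding prob_group_max_le[OF k] shape_def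
  using max_cdf_limit[OF sigma_pos[OF k] y N1_lim N_pos[OF k] N_lim[OF k]] assms(3)
  by (simp add: rate_def)

lemma group_max_1_limit:
  "y > 0 \<Longrightarrow> (\<lambda>n. measure (M n) {\<omega> \<in> space (M n). group_max n 1 \<omega> \<le> gumbel_level (N n 1) y})
    \<longlonglongrightarrow> exp (- y)"
  using group_max_limit[OF one_in, of y 1] sigma_1 by (simp add: rate_1[simplified] shape_def)

lemma win_prob_limit:
  assumes rate: "\<And>k. k \<in> {1..K} \<Longrightarrow> (\<lambda>n. rate n k) \<longlonglongrightarrow> a k"
    and a: "\<And>k. k \<in> {1..K} \<Longrightarrow> a k > 0" and k: "k \<in> {1..K}"
  shows "(\<lambda>n. win_prob (M n) K (group_max n) k) \<longlonglongrightarrow> race_prob K a shape k"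
proof -
  interpret L: weibull_race_limit K a shape M group_max "\<lambda>n. gumbel_level (N n 1)"
  proof (intro weibull_race_limit.intro weibull_race.intro weibull_race_limit_axioms.intro)
    fix j and y :: real assume "j \<in> {1..K}" "0 < y"
    then show "(\<lambda>n. measure (M n) {\<omega> \<in> space (M n). group_max n j \<omega> \<le> gumbel_level (N n 1) y})
        \<longlonglongrightarrow> exp (- (a j * y powr shape j))"
      by (intro group_max_limit rate)
  qed (fact K_ge_1 a shape_pos prob indep_group_max gumbel_level_antimono)+
  show ?thesis by (rule L.win_prob_tendsto_race_prob[OF k])
qed

text \<open>
  If the rate of group \<open>k\<close> explodes, its maximum passes every level \<open>gumbel_level (N n 1) y\<close>. The first
  group can beat it only by passing these levels as well, which has probability \<open>1 - exp (- y)\<close>,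
  arbitrarily small for small \<open>y\<close>.
\<close>

lemma rate_not_infinite:
  assumes k: "k \<in> {1..K}" and rate: "filterlim (\<lambda>n. rate n k) at_top sequentially"
    and lim: "(\<lambda>n. win_prob (M n) K (group_max n) 1) \<longlonglongrightarrow> q"
  shows "q \<le> 0"
proof -
  have k1: "k \<noteq> 1"
  proof
    assume "k = 1"
    then have "filterlim (\<lambda>n::nat. 1 :: real) at_top sequentially" using rate by (simp only: rate_1)
    then show False by (auto simp: filterlim_at_top dest: spec[of _ "2 :: real"])
  qed
  have "q \<le> 1 - exp (- y)" if y: "y > 0" for y
  proof (rule LIMSEQ_le[OF lim])
    let ?F = "\<lambda>n j. measure (M n) {\<omega> \<in> space (M n). group_max n j \<omega> \<le> gumbel_level (N n 1) y}"
    have "(\<lambda>n. ?F n k) \<longlonglongrightarrow> 0"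
      unfolding prob_group_max_le[OF k] using rate
      by (intro max_cdf_limit_infinite[OF sigma_pos[OF k] y N1_lim N_pos[OF k]]) (simp add: rate_def)
    then have "(\<lambda>n. 1 - ?F n 1 + ?F n k) \<longlonglongrightarrow> 1 - exp (- y) + 0"
      by (intro tendsto_intros group_max_1_limit y)
    then show "(\<lambda>n. 1 - ?F n 1 + ?F n k) \<longlonglongrightarrow> 1 - exp (- y)" by simp
    show "\<exists>n0. \<forall>n\<ge>n0. win_prob (M n) K (group_max n) 1 \<le> 1 - ?F n 1 + ?F n k"
      by (intro exI allI impI prob_space.win_prob_two_player_bound prob group_max_measurable one_in k k1)
  qed
  then have "eventually (\<lambda>y. q \<le> 1 - exp (- y)) (at_right 0)"
    unfolding eventually_at_right_field by (intro exI[of _ 1]) auto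
  moreover have "((\<lambda>y::real. 1 - exp (- y)) \<longlongrightarrow> 0) (at_right 0)" by real_asymp
  ultimately show ?thesis
    by (intro tendsto_lowerbound[of "\<lambda>y. 1 - exp (- y)"]) auto
qed

text \<open>
  If the rate of group \<open>k\<close> vanishes, its maximum stays below every level. It can beat the first group
  only if that one stays below too, which has probability \<open>exp (- y)\<close>, arbitrarily small for large \<open>y\<close>.
\<close>

lemma rate_not_zero:
  assumes k: "k \<in> {1..K}" and rate: "(\<lambda>n. rate n k) \<longlonglongrightarrow> 0"
    and lim: "(\<lambda>n. win_prob (M n) K (group_max n) k) \<longlonglongrightarrow> q"
  shows "q \<le> 0"
proof -
  have k1: "1 \<noteq> k"
  proof
    assume "1 = k"
    with rate have "(\<lambda>n::nat. 1 :: real) \<longlonglongrightarrow> 0" by (simp only: rate_1 flip: \<open>1 = k\<close>)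
    then show False by (simp add: LIMSEQ_const_iff)
  qed
  have "q \<le> exp (- y)" if y: "y > 0" for y
  proof (rule LIMSEQ_le[OF lim])
    let ?F = "\<lambda>n j. measure (M n) {\<omega> \<in> space (M n). group_max n j \<omega> \<le> gumbel_level (N n 1) y}"
    have "(\<lambda>n. 1 - ?F n k + ?F n 1) \<longlonglongrightarrow> 1 - exp (- (0 * y powr shape k)) + exp (- y)"
      by (intro tendsto_intros group_max_1_limit group_max_limit y k rate)
    then show "(\<lambda>n. 1 - ?F n k + ?F n 1) \<longlonglongrightarrow> exp (- y)" by simp
    show "\<exists>n0. \<forall>n\<ge>n0. win_prob (M n) K (group_max n) k \<le> 1 - ?F n k + ?F n 1"
      by (intro exI allI impI prob_space.win_prob_two_player_bound prob group_max_measurable one_in k k1)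
  qed
  then have "eventually (\<lambda>y. q \<le> exp (- y)) at_top"
    by (intro eventually_mono[OF eventually_gt_at_top[of "0 :: real"]])
  moreover have "((\<lambda>y::real. exp (- y)) \<longlongrightarrow> 0) at_top" by real_asymp
  ultimately show ?thesis
    by (intro tendsto_lowerbound[of "\<lambda>y. exp (- y)"]) auto
qed

text \<open>
  The rates always have limit points in the extended reals; the two preceding lemmas, applied along
  the subsequence, exclude \<open>0\<close> and \<open>\<infinity>\<close>.
\<close>

lemma rates_convergent_subseq:
  assumes lim: "\<And>k. k \<in> {1..K} \<Longrightarrow> (\<lambda>n. win_prob (M n) K (group_max n) k) \<longlonglongrightarrow> q k"
    and q: "\<And>k. k \<in> {1..K} \<Longrightarrow> q k > 0"
  obtains t a where "strict_mono t" "\<And>k. k \<in> {1..K} \<Longrightarrow> a k > 0"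
    "\<And>k. k \<in> {1..K} \<Longrightarrow> (\<lambda>n. rate (t n) k) \<longlonglongrightarrow> a k"
proof -
  obtain t l where t: "strict_mono t"
    and l: "\<And>k. k \<in> {1..K} \<Longrightarrow> (\<lambda>n. ereal (rate (t n) k)) \<longlonglongrightarrow> l k"
    using finite_family_convergent_subseq[of "{1..K}" "\<lambda>k n. ereal (rate n k)"] by auto
  interpret T: gaussian_race K \<sigma> "\<lambda>n. N (t n)" "\<lambda>n. M (t n)" "\<lambda>n. X (t n)"
    by (rule subseq[OF t])
  have T: "T.rate n = rate (t n)" "T.group_max n = group_max (t n)" for n
    by (simp_all add: fun_eq_iff T.rate_def rate_def T.group_max_def group_max_def)
  have lim': "(\<lambda>n. win_prob (M (t n)) K (group_max (t n)) k) \<longlonglongrightarrow> q k" if "k \<in> {1..K}" for k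
    using LIMSEQ_subseq_LIMSEQ[OF lim[OF that] t] by (simp add: comp_def)
  have "\<exists>a>0. l k = ereal a" if k: "k \<in> {1..K}" for k
  proof (cases "l k")
    case (real a)
    have "(\<lambda>n. rate (t n) k) \<longlonglongrightarrow> a"
      using l[OF k] by (simp add: real)
    moreover from this have "0 \<le> a"
      using rate_pos by (intro LIMSEQ_le_const) (auto intro: less_imp_le)
    ultimately show ?thesis
      using T.rate_not_zero[OF k, of "q k"] lim'[OF k] q[OF k] real by (cases "a = 0") (auto simp: T)
  next
    case PInf
    then have "filterlim (\<lambda>n. rate (t n) k) at_top sequentially"
      using l[OF k] by (simp add: tendsto_PInfty_eq_at_top)
    then show ?thesis
      using T.rate_not_infinite[OF k, of "q 1"] lim'[OF one_in] q[OF one_in] by (simp add: T)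
  next
    case MInf
    have "0 \<le> l k"
      using rate_pos by (intro LIMSEQ_le_const[OF l[OF k]]) (auto intro: less_imp_le)
    then show ?thesis using MInf by simp
  qed
  then obtain a where a: "\<And>k. k \<in> {1..K} \<Longrightarrow> a k > 0" "\<And>k. k \<in> {1..K} \<Longrightarrow> l k = ereal (a k)"
    by metis
  show ?thesis
    by (rule that[OF t a(1)]) (use a(2) l in auto)
qed

text \<open>
  Every limit point of the rates produces the same winning probabilities \<open>q\<close>, and the first rate is
  always \<open>1\<close>. By injectivity there is only one limit point.
\<close>

lemma rates_converge:
  assumes lim: "\<And>k. k \<in> {1..K} \<Longrightarrow> (\<lambda>n. win_prob (M n) K (group_max n) k) \<longlonglongrightarrow> q k"
    and q: "\<And>k. k \<in> {1..K} \<Longrightarrow> q k > 0"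
  obtains a where "\<And>k. k \<in> {1..K} \<Longrightarrow> a k > 0" "\<And>k. k \<in> {1..K} \<Longrightarrow> (\<lambda>n. rate n k) \<longlonglongrightarrow> a k"
proof -
  have along: "\<exists>t a. strict_mono t \<and> weibull_race K a shape \<and> a 1 = 1
      \<and> (\<forall>k\<in>{1..K}. (\<lambda>n. rate (r (t n)) k) \<longlonglongrightarrow> a k \<and> race_prob K a shape k = q k)"
    if r: "strict_mono r" for r :: "nat \<Rightarrow> nat"
  proof -
    interpret R: gaussian_race K \<sigma> "\<lambda>n. N (r n)" "\<lambda>n. M (r n)" "\<lambda>n. X (r n)"
      by (rule subseq[OF r])
    have R: "R.rate n = rate (r n)" "R.group_max n = group_max (r n)" for n
      by (simp_all add: fun_eq_iff R.rate_def rate_def R.group_max_def group_max_def)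
    have limR: "(\<lambda>n. win_prob (M (r n)) K (R.group_max n) k) \<longlonglongrightarrow> q k" if "k \<in> {1..K}" for k
      using LIMSEQ_subseq_LIMSEQ[OF lim[OF that] r] by (simp add: comp_def R)
    obtain t a where t: "strict_mono t" and a: "\<And>k. k \<in> {1..K} \<Longrightarrow> a k > 0"
      "\<And>k. k \<in> {1..K} \<Longrightarrow> (\<lambda>n. R.rate (t n) k) \<longlonglongrightarrow> a k"
      using R.rates_convergent_subseq[OF limR q] by blast
    interpret T: gaussian_race K \<sigma> "\<lambda>n. N (r (t n))" "\<lambda>n. M (r (t n))" "\<lambda>n. X (r (t n))"
      by (rule R.subseq[OF t])
    have T: "T.rate n = rate (r (t n))" "T.group_max n = R.group_max (t n)" for n
      by (simp_all add: fun_eq_iff T.rate_def rate_def T.group_max_def R.group_max_def)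
    have rates: "(\<lambda>n. rate (r (t n)) k) \<longlonglongrightarrow> a k" if "k \<in> {1..K}" for k
      using a(2)[OF that] by (simp add: R)
    have "race_prob K a shape k = q k" if k: "k \<in> {1..K}" for k
    proof (rule LIMSEQ_unique)
      show "(\<lambda>n. win_prob (M (r (t n))) K (T.group_max n) k) \<longlonglongrightarrow> race_prob K a shape k"
        by (rule T.win_prob_limit[OF _ a(1) k]) (simp_all add: T rates)
      show "(\<lambda>n. win_prob (M (r (t n))) K (T.group_max n) k) \<longlonglongrightarrow> q k"
        using LIMSEQ_subseq_LIMSEQ[OF limR[OF k] t] by (simp add: comp_def T)
    qed
    moreover have "a 1 = 1"
      using rates[OF one_in] rate_1 by (simp add: LIMSEQ_const_iff)
    moreover have "weibull_race K a shape"
      using K_ge_1 a(1) shape_pos by unfold_locales auto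
    ultimately show ?thesis using t rates by blast
  qed
  from along[of id] obtain t a where a: "weibull_race K a shape" "a 1 = 1"
      "\<And>k. k \<in> {1..K} \<Longrightarrow> race_prob K a shape k = q k"
    by (auto simp: strict_mono_def)
  have conv: "(\<lambda>n. rate n k) \<longlonglongrightarrow> a k" if k: "k \<in> {1..K}" for k
  proof (rule LIMSEQ_if_subsubseq)
    fix r :: "nat \<Rightarrow> nat" assume "strict_mono r"
    from along[OF this] obtain t a' where t: "strict_mono t" and
      a': "weibull_race K a' shape" "a' 1 = 1"
      "\<And>k. k \<in> {1..K} \<Longrightarrow> race_prob K a' shape k = q k" "(\<lambda>n. rate (r (t n)) k) \<longlonglongrightarrow> a' k"
      using k by blast
    have "a' k = a k"
      by (rule race_prob_inject[OF a'(1) a(1) _ _ k]) (use a a' in auto)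
    then show "\<exists>t. strict_mono t \<and> (\<lambda>n. rate (r (t n)) k) \<longlonglongrightarrow> a k"
      using t a'(4) by auto
  qed
  show ?thesis
    by (rule that[OF weibull_race.a_pos[OF a(1)] conv])
qed

end

section \<open>Gumbel representation and the equivalence\<close>

text \<open>
  The levels \<open>- ln y\<close> turn a shifted and scaled Gumbel variable into an exact Weibull clock, so this is
  the limit theorem for a constant sequence.
\<close>

lemma gumbel_win_prob:
  assumes "weibull_race K a b" and P: "prob_space P"
    and indep: "prob_space.indep_vars P (\<lambda>_. borel) \<Lambda> {1..K}"
    and gumbel: "\<And>j. j \<in> {1..K} \<Longrightarrow> gumbel_rv P (\<Lambda> j)"
    and k: "k \<in> {1..K}"
  shows "win_prob P K (\<lambda>j \<omega>. (\<Lambda> j \<omega> + ln (a j)) / b j) k = race_prob K a b k"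
proof -
  interpret R: weibull_race K a b by fact
  interpret P: prob_space P by fact
  let ?Y = "\<lambda>j \<omega>. (\<Lambda> j \<omega> + ln (a j)) / b j"
  have "weibull_race_limit K a b (\<lambda>n::nat. P) (\<lambda>n. ?Y) (\<lambda>n y. - ln y)"
  proof (intro weibull_race_limit.intro weibull_race_limit_axioms.intro)
    show "P.indep_vars (\<lambda>_. borel) ?Y {1..K}"
      by (rule P.indep_vars_compose2[OF indep, of "\<lambda>j x. (x + ln (a j)) / b j"]) measurable
    fix j and y :: real assume j: "j \<in> {1..K}" and y: "0 < y"
    have [measurable]: "\<Lambda> j \<in> borel_measurable P"
      using gumbel[OF j] by (simp add: gumbel_rv_def)
    have "{\<omega> \<in> space P. ?Y j \<omega> \<le> - ln y} = \<Lambda> j -` {..- (b j * ln y + ln (a j))} \<inter> space P"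
      using R.b_pos[OF j] by (auto simp: field_simps)
    also have "P.prob \<dots> = cdf (distr P borel (\<Lambda> j)) (- (b j * ln y + ln (a j)))"
      by (simp add: cdf_def measure_distr)
    also have "\<dots> = exp (- exp (b j * ln y + ln (a j)))"
      using gumbel[OF j] by (simp add: gumbel_rv_def)
    also have "\<dots> = exp (- (a j * y powr b j))"
      using R.a_pos[OF j] y by (simp add: exp_add powr_def)
    finally show "(\<lambda>n::nat. P.prob {\<omega> \<in> space P. ?Y j \<omega> \<le> - ln y}) \<longlonglongrightarrow> exp (- (a j * y powr b j))"
      by simp
  qed (use assms in auto)
  then have "(\<lambda>n::nat. win_prob P K ?Y k) \<longlonglongrightarrow> race_prob K a b k"
    using k by (rule weibull_race_limit.win_prob_tendsto_race_prob)
  then show ?thesis by (simp add: LIMSEQ_const_iff)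
qed

theorem theorem2:
  fixes K :: nat
    and \<sigma> :: "nat \<Rightarrow> real"
    and N :: "nat \<Rightarrow> nat \<Rightarrow> nat"
    and M :: "nat \<Rightarrow> 'a measure"
    and X :: "nat \<Rightarrow> nat \<Rightarrow> nat \<Rightarrow> 'a \<Rightarrow> real"
    and p :: "nat \<Rightarrow> nat \<Rightarrow> real"
    and \<beta> :: "nat \<Rightarrow> nat \<Rightarrow> real"
  assumes K: "K \<ge> 2"
    and sigma_1: "\<sigma> 1 = 1"
    and sigma_gt_1: "\<And>k. k \<in> {2..K} \<Longrightarrow> \<sigma> k > 1"
    and N_pos: "\<And>n k. k \<in> {1..K} \<Longrightarrow> N n k > 0"
    and N_lim: "\<And>k. k \<in> {1..K} \<Longrightarrow> filterlim (\<lambda>n. N n k) at_top sequentially"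
    and prob: "\<And>n. prob_space (M n)"
    and normal: "\<And>n k i. k \<in> {1..K} \<Longrightarrow> i \<in> {1..N n k} \<Longrightarrow>
          distributed (M n) lborel (X n k i) (normal_density 0 (\<sigma> k))"
    and indep_within: "\<And>n k. k \<in> {1..K} \<Longrightarrow>
          prob_space.indep_vars (M n) (\<lambda>_. borel) (X n k) {1..N n k}"
    and indep_across: "\<And>n.
          prob_space.indep_vars (M n) (\<lambda>k. Pi\<^sub>M {1..N n k} (\<lambda>_. borel))
            (\<lambda>k \<omega>. \<lambda>i \<in> {1..N n k}. X n k i \<omega>) {1..K}"
    and p_def: "\<And>n k. p n k = win_prob (M n) K (\<lambda>j. sample_max (X n j) (N n j)) k"
    and beta_def: "\<And>n k. \<beta> n k = beta_ratio \<sigma> (N n) k"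
  shows "((\<exists>q. tuple_limit_in K {0<..<1} p q) \<longleftrightarrow> (\<exists>C. tuple_limit_in K {0<..} \<beta> C)) \<and>
    (\<forall>q C. tuple_limit_in K {0<..<1} p q \<longrightarrow> tuple_limit_in K {0<..} \<beta> C \<longrightarrow>
      C 1 = 1 \<and> kappa (C 1) (\<sigma> 1) = 0 \<and>
      (\<forall>k \<in> {1..K}.
        (\<forall>(P :: 'b measure) \<Lambda>.
          prob_space P \<longrightarrow>
          prob_space.indep_vars P (\<lambda>_. borel) \<Lambda> {1..K} \<longrightarrow>
          (\<forall>j \<in> {1..K}. gumbel_rv P (\<Lambda> j)) \<longrightarrow>
          q k = win_prob P K (\<lambda>j \<omega>. (\<sigma> j)\<^sup>2 * (\<Lambda> j \<omega> - kappa (C j) (\<sigma> j))) k) \<and>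
        q k = (LINT x:{0<..}|lborel.
          exp (- kappa (C k) (\<sigma> k)) / (\<sigma> k)\<^sup>2 * x powr (1 / (\<sigma> k)\<^sup>2 - 1) *
          exp (- (\<Sum>j = 1..K. exp (- kappa (C j) (\<sigma> j)) * x powr (1 / (\<sigma> j)\<^sup>2))))))"
proof -
  have sigma_pos: "\<sigma> k > 0" if "k \<in> {1..K}" for k
    using that sigma_1 sigma_gt_1[of k] by (cases "k = 1") force+
  interpret G: gaussian_race K \<sigma> N M X
  proof (rule gaussian_race.intro)
    show "1 \<le> K" using K by simp
  qed (fact sigma_1 sigma_pos N_pos N_lim prob normal indep_within indep_across)+
  have p_eq: "p n k = win_prob (M n) K (G.group_max n) k" for n k
    unfolding p_def G.group_max_def[abs_def] ..
  have beta_1: "\<beta> n 1 = 1" for n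
    by (simp add: beta_def beta_ratio_def)
  have beta_eq: "\<beta> n k = size_ratio (\<sigma> k) (N n 1) (N n k)" if "k \<noteq> 1" for n k
    using that by (simp add: beta_def beta_ratio_def size_ratio_def)
  have kappa_1: "kappa 1 1 = 0" by (simp add: kappa_def)
  have C_1: "C 1 = 1" if "tuple_limit_in K {0<..} \<beta> C" for C
  proof -
    have "(\<lambda>n. \<beta> n 1) \<longlonglongrightarrow> C 1"
      using that G.one_in unfolding tuple_limit_in_def by blast
    then show ?thesis by (simp only: beta_1 LIMSEQ_const_iff)
  qed
  define a where "a C k = exp (- kappa (C k) (\<sigma> k))" for C k
  have rate_lim: "(\<lambda>n. G.rate n k) \<longlonglongrightarrow> a C k"
    if C: "tuple_limit_in K {0<..} \<beta> C" and k: "k \<in> {1..K}" for C k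
  proof (cases "k = 1")
    case True
    then show ?thesis
      using G.rate_1 C_1[OF C] sigma_1 kappa_1 by (simp only: a_def minus_zero exp_zero tendsto_const)
  next
    case False
    have "(\<lambda>n. \<beta> n k) \<longlonglongrightarrow> C k" "C k > 0"
      using C k by (auto simp: tuple_limit_in_def)
    then show ?thesis
      unfolding G.rate_def a_def beta_eq[OF False]
      by (intro clock_rate_limit_of_size_ratio[OF sigma_pos[OF k] G.N1_lim N_lim[OF k]])
  qed
  have race: "weibull_race K (a C) G.shape" for C
    using K G.shape_pos by unfold_locales (auto simp: a_def)
  have p_lim: "(\<lambda>n. p n k) \<longlonglongrightarrow> race_prob K (a C) G.shape k"
    if C: "tuple_limit_in K {0<..} \<beta> C" and k: "k \<in> {1..K}" for C k
    unfolding p_eq by (rule G.win_prob_limit[OF rate_lim[OF C] _ k]) (simp_all add: a_def)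
  have fwd: "\<exists>q. tuple_limit_in K {0<..<1} p q" if C: "tuple_limit_in K {0<..} \<beta> C" for C
    using p_lim[OF C] weibull_race.race_prob_pos[OF race[of C]]
      weibull_race.race_prob_less_1[OF race[of C] K]
    by (intro exI[of _ "race_prob K (a C) G.shape"]) (simp add: tuple_limit_in_def)
  have bwd: "\<exists>C. tuple_limit_in K {0<..} \<beta> C" if q: "tuple_limit_in K {0<..<1} p q" for q
  proof -
    have "(\<lambda>n. win_prob (M n) K (G.group_max n) k) \<longlonglongrightarrow> q k" "q k > 0" if "k \<in> {1..K}" for k
      using q that by (auto simp: tuple_limit_in_def p_eq)
    then obtain r where r: "\<And>k. k \<in> {1..K} \<Longrightarrow> r k > 0"
        "\<And>k. k \<in> {1..K} \<Longrightarrow> (\<lambda>n. G.rate n k) \<longlonglongrightarrow> r k"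
      using G.rates_converge[of q] by blast
    have "\<exists>c>0. (\<lambda>n. \<beta> n k) \<longlonglongrightarrow> c" if k: "k \<in> {1..K}" for k
    proof (cases "k = 1")
      case True
      then show ?thesis using beta_1 by (intro exI[of _ 1]) simp
    next
      case False
      have "(\<lambda>n. clock_rate (\<sigma> k) (N n 1) (N n k)) \<longlonglongrightarrow> r k"
        using r(2)[OF k] by (simp add: G.rate_def)
      from size_ratio_limit_of_clock_rate[OF sigma_pos[OF k] G.N1_lim N_lim[OF k] r(1)[OF k] this]
      show ?thesis using False by (auto simp: beta_eq)
    qed
    then obtain C where "\<And>k. k \<in> {1..K} \<Longrightarrow> C k > 0 \<and> (\<lambda>n. \<beta> n k) \<longlonglongrightarrow> C k"
      by metis
    then show ?thesis
      by (intro exI[of _ C]) (simp add: tuple_limit_in_def)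
  qed
  have norm: "C 1 = 1 \<and> kappa (C 1) (\<sigma> 1) = 0" if "tuple_limit_in K {0<..} \<beta> C" for C
    using C_1[OF that] kappa_1 sigma_1 by simp
  have q_eq: "q k = race_prob K (a C) G.shape k"
    if "tuple_limit_in K {0<..<1} p q" "tuple_limit_in K {0<..} \<beta> C" "k \<in> {1..K}" for q C k
    using that p_lim LIMSEQ_unique unfolding tuple_limit_in_def by blast
  have gumbel: "race_prob K (a C) G.shape k
      = win_prob P K (\<lambda>j \<omega>. (\<sigma> j)\<^sup>2 * (\<Lambda> j \<omega> - kappa (C j) (\<sigma> j))) k"
    if "prob_space P" "prob_space.indep_vars P (\<lambda>_. borel) \<Lambda> {1..K}"
      "\<forall>j \<in> {1..K}. gumbel_rv P (\<Lambda> j)" "k \<in> {1..K}" for C k and P :: "'b measure" and \<Lambda>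
    using gumbel_win_prob[OF race that(1,2) _ that(4), of C] that(3)
    by (simp add: a_def G.shape_def mult.commute)
  have integral: "race_prob K (a C) G.shape k = (LINT x:{0<..}|lborel.
      exp (- kappa (C k) (\<sigma> k)) / (\<sigma> k)\<^sup>2 * x powr (1 / (\<sigma> k)\<^sup>2 - 1) *
      exp (- (\<Sum>j = 1..K. exp (- kappa (C j) (\<sigma> j)) * x powr (1 / (\<sigma> j)\<^sup>2))))" for C k
    by (simp add: race_prob_def race_density_def race_survival_def a_def G.shape_def)
  show ?thesis
  proof (rule conjI)
    show "(\<exists>q. tuple_limit_in K {0<..<1} p q) \<longleftrightarrow> (\<exists>C. tuple_limit_in K {0<..} \<beta> C)"
      using fwd bwd by blast
    show "\<forall>q C. tuple_limit_in K {0<..<1} p q \<longrightarrow> tuple_limit_in K {0<..} \<beta> C \<longrightarrow>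
      C 1 = 1 \<and> kappa (C 1) (\<sigma> 1) = 0 \<and>
      (\<forall>k \<in> {1..K}.
        (\<forall>(P :: 'b measure) \<Lambda>.
          prob_space P \<longrightarrow>
          prob_space.indep_vars P (\<lambda>_. borel) \<Lambda> {1..K} \<longrightarrow>
          (\<forall>j \<in> {1..K}. gumbel_rv P (\<Lambda> j)) \<longrightarrow>
          q k = win_prob P K (\<lambda>j \<omega>. (\<sigma> j)\<^sup>2 * (\<Lambda> j \<omega> - kappa (C j) (\<sigma> j))) k) \<and>
        q k = (LINT x:{0<..}|lborel.
          exp (- kappa (C k) (\<sigma> k)) / (\<sigma> k)\<^sup>2 * x powr (1 / (\<sigma> k)\<^sup>2 - 1) *
          exp (- (\<Sum>j = 1..K. exp (- kappa (C j) (\<sigma> j)) * x powr (1 / (\<sigma> j)\<^sup>2)))))"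
      by (intro allI impI conjI ballI norm[THEN conjunct1] norm[THEN conjunct2]
          trans[OF q_eq gumbel] trans[OF q_eq integral]) blast+
  qed
qed

end
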